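(* Let $I$ be a $2$-category and let $F\colon I\to\mathsf{Cat}$ be a $2$-functor. A pair $(\mathcal{L},\lambda\colon\Delta\mathcal{L}\Rightarrow F)$ is $2$-terminal in the strict-slice $\Delta\downarrow_s F$ of $2$-cones over $F$ if and only if it is a $2$-limit of $F$.
   Context: $\mathsf{Cat}$ is the $2$-category of small categories, functors and natural transformations; write $\mathcal{A}=\mathsf{Cat}$ below. $2$-categories and $2$-functors are strict; $*$ denotes horizontal composition (and whiskering) of $2$-morphisms. A $2$-natural transformation $\mu\colon F\Rightarrow G$ between $2$-functors $F,G\colon I\to\mathcal{A}$ consists of morphisms $\mu_i\colon Fi\to Gi$ with $(Gf)\mu_i=\mu_j(Ff)$ for every $f\colon i\to j$ in $I$ and $G\alpha*\mu_i=\mu_j*F\alpha$ for every $2$-morphism $\alpha\colon f\Rightarrow g$ in $I$. A modification $\varphi\colon\mu\to\nu$ consists of $2$-morphisms $\varphi_i\colon\mu_i\Rightarrow\nu_i$ with $Gf*\varphi_i=\varphi_j*Ff$ for every $f\colon i\to j$. $[I,\mathcal{A}]$ is the $2$-category of $2$-functors, $2$-natural transformations and modifications; $\Delta X$ is the constant $2$-functor at $X$; a $2$-cone over $F$ is a $2$-natural transformation $\Delta X\Rightarrow F$. A $2$-limit of $F$ is a pair $(L,\lambda\colon\Delta L\Rightarrow F)$ with $\lambda$ a $2$-cone such that for each $X\in\mathcal{A}$ the functor $\lambda_*\circ\Delta\colon\mathcal{A}(X,L)\to[I,\mathcal{A}](\Delta X,F)$, given by post-composition with $\lambda$, is an isomorphism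 of categories. The strict-slice $\Delta\downarrow_s F$ is the $2$-category whose objects are pairs $(X,\mu)$ with $\mu\colon\Delta X\Rightarrow F$ a $2$-cone; morphisms $(X,\mu)\to(Y,\nu)$ are morphisms $f\colon X\to Y$ of $\mathcal{A}$ with $\nu\Delta f=\mu$; $2$-morphisms $f\Rightarrow g$ are $2$-morphisms $\alpha\colon f\Rightarrow g$ of $\mathcal{A}$ with $\nu*\Delta\alpha=\mathrm{id}_\mu$. An object $L$ of a $2$-category $\mathcal{B}$ is $2$-terminal if for all $X\in\mathcal{B}$ the category $\mathcal{B}(X,L)$ is isomorphic to the terminal category $\mathbb{1}$. *)

theory Defs
  imports "HOL-Library.FuncSet"
begin

section \<open>Categories, functors and natural transformations\<close>

text \<open>Composition is written in applicative order: \<open>Comp C g f\<close> is $g \circ f$.\<close>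

record ('o, 'a) cat =
  Obj :: "'o set"
  Arr :: "'a set"
  Dom :: "'a \<Rightarrow> 'o"
  Cod :: "'a \<Rightarrow> 'o"
  Ident :: "'o \<Rightarrow> 'a"
  Comp :: "'a \<Rightarrow> 'a \<Rightarrow> 'a"

definition category :: "('o, 'a) cat \<Rightarrow> bool" where
  "category C \<longleftrightarrow>
     (\<forall>f\<in>Arr C. Dom C f \<in> Obj C \<and> Cod C f \<in> Obj C) \<and>
     (\<forall>x\<in>Obj C. Ident C x \<in> Arr C \<and> Dom C (Ident C x) = x \<and> Cod C (Ident C x) = x) \<and>
     (\<forall>f\<in>Arr C. \<forall>g\<in>Arr C. Dom C g = Cod C f \<longrightarrow>
        Comp C g f \<in> Arr C \<and> Dom C (Comp C g f) = Dom C f \<and> Cod C (Comp C g f) = Cod C g) \<and>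
     (\<forall>f\<in>Arr C. Comp C f (Ident C (Dom C f)) = f \<and> Comp C (Ident C (Cod C f)) f = f) \<and>
     (\<forall>f\<in>Arr C. \<forall>g\<in>Arr C. \<forall>h\<in>Arr C. Dom C g = Cod C f \<and> Dom C h = Cod C g \<longrightarrow>
        Comp C h (Comp C g f) = Comp C (Comp C h g) f)"

record ('o, 'a, 'p, 'b) func =
  fdom :: "('o, 'a) cat"
  fcod :: "('p, 'b) cat"
  fobj :: "'o \<Rightarrow> 'p"
  farr :: "'a \<Rightarrow> 'b"

text \<open>The maps of a functor are required to be \<open>undefined\<close> outside the objects and arrows of its
  domain, so that equality of records is equality of functors. The same convention is used for
  all other structures below that occur as cells of some 2-category.\<close>

definition is_functor :: "('o, 'a, 'p, 'b) func \<Rightarrow> bool" where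
  "is_functor F \<longleftrightarrow>
     category (fdom F) \<and> category (fcod F) \<and>
     fobj F \<in> Obj (fdom F) \<rightarrow>\<^sub>E Obj (fcod F) \<and>
     farr F \<in> Arr (fdom F) \<rightarrow>\<^sub>E Arr (fcod F) \<and>
     (\<forall>f\<in>Arr (fdom F). Dom (fcod F) (farr F f) = fobj F (Dom (fdom F) f) \<and>
                       Cod (fcod F) (farr F f) = fobj F (Cod (fdom F) f)) \<and>
     (\<forall>x\<in>Obj (fdom F). farr F (Ident (fdom F) x) = Ident (fcod F) (fobj F x)) \<and>
     (\<forall>f\<in>Arr (fdom F). \<forall>g\<in>Arr (fdom F). Dom (fdom F) g = Cod (fdom F) f \<longrightarrow>
        farr F (Comp (fdom F) g f) = Comp (fcod F) (farr F g) (farr F f))"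

definition id_functor :: "('o, 'a) cat \<Rightarrow> ('o, 'a, 'o, 'a) func" where
  "id_functor C = \<lparr>fdom = C, fcod = C, fobj = (\<lambda>x\<in>Obj C. x), farr = (\<lambda>f\<in>Arr C. f)\<rparr>"

definition comp_functor ::
  "('p, 'b, 'q, 'c) func \<Rightarrow> ('o, 'a, 'p, 'b) func \<Rightarrow> ('o, 'a, 'q, 'c) func" where
  "comp_functor G F = \<lparr>fdom = fdom F, fcod = fcod G,
     fobj = (\<lambda>x\<in>Obj (fdom F). fobj G (fobj F x)),
     farr = (\<lambda>f\<in>Arr (fdom F). farr G (farr F f))\<rparr>"

definition is_iso_functor :: "('o, 'a, 'p, 'b) func \<Rightarrow> bool" where
  "is_iso_functor F \<longleftrightarrow> is_functor F \<and>
     (\<exists>G. is_functor G \<and> fdom G = fcod F \<and> fcod G = fdom F \<and>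
          comp_functor G F = id_functor (fdom F) \<and> comp_functor F G = id_functor (fcod F))"

definition isomorphic_cats :: "('o, 'a) cat \<Rightarrow> ('p, 'b) cat \<Rightarrow> bool" where
  "isomorphic_cats C D \<longleftrightarrow> (\<exists>F. is_iso_functor F \<and> fdom F = C \<and> fcod F = D)"

definition terminal_cat :: "(unit, unit) cat" where
  "terminal_cat = \<lparr>Obj = {()}, Arr = {()}, Dom = (\<lambda>_. ()), Cod = (\<lambda>_. ()),
     Ident = (\<lambda>_. ()), Comp = (\<lambda>_ _. ())\<rparr>"

record ('o, 'a, 'p, 'b) ntrans =
  ndom :: "('o, 'a, 'p, 'b) func"
  ncod :: "('o, 'a, 'p, 'b) func"
  ncmp :: "'o \<Rightarrow> 'b"

definition is_ntrans :: "('o, 'a, 'p, 'b) ntrans \<Rightarrow> bool" where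
  "is_ntrans t \<longleftrightarrow>
     (let F = ndom t; G = ncod t; C = fdom F; D = fcod F in
       is_functor F \<and> is_functor G \<and> fdom G = C \<and> fcod G = D \<and>
       ncmp t \<in> Obj C \<rightarrow>\<^sub>E Arr D \<and>
       (\<forall>x\<in>Obj C. Dom D (ncmp t x) = fobj F x \<and> Cod D (ncmp t x) = fobj G x) \<and>
       (\<forall>f\<in>Arr C. Comp D (ncmp t (Cod C f)) (farr F f) = Comp D (farr G f) (ncmp t (Dom C f))))"

definition id_ntrans :: "('o, 'a, 'p, 'b) func \<Rightarrow> ('o, 'a, 'p, 'b) ntrans" where
  "id_ntrans F = \<lparr>ndom = F, ncod = F, ncmp = (\<lambda>x\<in>Obj (fdom F). Ident (fcod F) (fobj F x))\<rparr>"

definition vcomp_ntrans ::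
  "('o, 'a, 'p, 'b) ntrans \<Rightarrow> ('o, 'a, 'p, 'b) ntrans \<Rightarrow> ('o, 'a, 'p, 'b) ntrans" where
  "vcomp_ntrans t s = \<lparr>ndom = ndom s, ncod = ncod t,
     ncmp = (\<lambda>x\<in>Obj (fdom (ndom s)). Comp (fcod (ndom s)) (ncmp t x) (ncmp s x))\<rparr>"

text \<open>For $s : F \Rightarrow G : C \to D$ and $t : H \Rightarrow K : D \to E$, the component of
  $t * s : HF \Rightarrow KG$ at $x$ is $t_{Gx} \circ H s_x$.\<close>

definition hcomp_ntrans ::
  "('p, 'b, 'q, 'c) ntrans \<Rightarrow> ('o, 'a, 'p, 'b) ntrans \<Rightarrow> ('o, 'a, 'q, 'c) ntrans" where
  "hcomp_ntrans t s = \<lparr>ndom = comp_functor (ndom t) (ndom s), ncod = comp_functor (ncod t) (ncod s),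
     ncmp = (\<lambda>x\<in>Obj (fdom (ndom s)).
       Comp (fcod (ndom t)) (ncmp t (fobj (ncod s) x)) (farr (ndom t) (ncmp s x)))\<rparr>"


section \<open>Strict 2-categories\<close>

record ('o, 'm, 't) two_cat =
  Obj0 :: "'o set"
  Mor1 :: "'m set"
  Mor2 :: "'t set"
  dom1 :: "'m \<Rightarrow> 'o"
  cod1 :: "'m \<Rightarrow> 'o"
  dom2 :: "'t \<Rightarrow> 'm"
  cod2 :: "'t \<Rightarrow> 'm"
  id1 :: "'o \<Rightarrow> 'm"
  id2 :: "'m \<Rightarrow> 't"
  comp1 :: "'m \<Rightarrow> 'm \<Rightarrow> 'm"
  vcomp :: "'t \<Rightarrow> 't \<Rightarrow> 't"
  hcomp :: "'t \<Rightarrow> 't \<Rightarrow> 't"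

text \<open>The three categories in the definition are: objects and morphisms; morphisms and
  2-morphisms under vertical composition (the disjoint union of the hom-categories); objects and
  2-morphisms under horizontal composition. The remaining clauses say that horizontal composition
  is functorial on the hom-categories.\<close>

definition two_category :: "('o, 'm, 't) two_cat \<Rightarrow> bool" where
  "two_category B \<longleftrightarrow>
     category \<lparr>Obj = Obj0 B, Arr = Mor1 B, Dom = dom1 B, Cod = cod1 B,
               Ident = id1 B, Comp = comp1 B\<rparr> \<and>
     category \<lparr>Obj = Mor1 B, Arr = Mor2 B, Dom = dom2 B, Cod = cod2 B,
               Ident = id2 B, Comp = vcomp B\<rparr> \<and>
     category \<lparr>Obj = Obj0 B, Arr = Mor2 B, Dom = (\<lambda>a. dom1 B (dom2 B a)),
               Cod = (\<lambda>a. cod1 B (dom2 B a)), Ident = (\<lambda>x. id2 B (id1 B x)), Comp = hcomp B\<rparr> \<and>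
     (\<forall>a\<in>Mor2 B. dom1 B (cod2 B a) = dom1 B (dom2 B a) \<and> cod1 B (cod2 B a) = cod1 B (dom2 B a)) \<and>
     (\<forall>a\<in>Mor2 B. \<forall>b\<in>Mor2 B. dom1 B (dom2 B b) = cod1 B (dom2 B a) \<longrightarrow>
        dom2 B (hcomp B b a) = comp1 B (dom2 B b) (dom2 B a) \<and>
        cod2 B (hcomp B b a) = comp1 B (cod2 B b) (cod2 B a)) \<and>
     (\<forall>f\<in>Mor1 B. \<forall>g\<in>Mor1 B. dom1 B g = cod1 B f \<longrightarrow>
        hcomp B (id2 B g) (id2 B f) = id2 B (comp1 B g f)) \<and>
     (\<forall>a\<in>Mor2 B. \<forall>a'\<in>Mor2 B. \<forall>b\<in>Mor2 B. \<forall>b'\<in>Mor2 B.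
        dom2 B a' = cod2 B a \<and> dom2 B b' = cod2 B b \<and> dom1 B (dom2 B b) = cod1 B (dom2 B a) \<longrightarrow>
        hcomp B (vcomp B b' b) (vcomp B a' a) = vcomp B (hcomp B b' a') (hcomp B b a))"

definition hom_cat :: "('o, 'm, 't) two_cat \<Rightarrow> 'o \<Rightarrow> 'o \<Rightarrow> ('m, 't) cat" where
  "hom_cat B X Y = \<lparr>
     Obj = {f \<in> Mor1 B. dom1 B f = X \<and> cod1 B f = Y},
     Arr = {a \<in> Mor2 B. dom1 B (dom2 B a) = X \<and> cod1 B (dom2 B a) = Y},
     Dom = dom2 B, Cod = cod2 B, Ident = id2 B, Comp = vcomp B\<rparr>"

definition two_terminal :: "('o, 'm, 't) two_cat \<Rightarrow> 'o \<Rightarrow> bool" where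
  "two_terminal B L \<longleftrightarrow>
     L \<in> Obj0 B \<and> (\<forall>X\<in>Obj0 B. isomorphic_cats (hom_cat B X L) terminal_cat)"

definition post_comp :: "('o, 'm, 't) two_cat \<Rightarrow> 'o \<Rightarrow> 'm \<Rightarrow> ('m, 't, 'm, 't) func" where
  "post_comp B W g = \<lparr>fdom = hom_cat B W (dom1 B g), fcod = hom_cat B W (cod1 B g),
     fobj = (\<lambda>f\<in>Obj (hom_cat B W (dom1 B g)). comp1 B g f),
     farr = (\<lambda>a\<in>Arr (hom_cat B W (dom1 B g)). hcomp B (id2 B g) a)\<rparr>"


section \<open>2-functors, 2-natural transformations and modifications\<close>

record ('i, 'j, 'k, 'o, 'm, 't) two_func =
  on0 :: "'i \<Rightarrow> 'o"
  on1 :: "'j \<Rightarrow> 'm"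
  on2 :: "'k \<Rightarrow> 't"

definition is_two_functor ::
  "('i, 'j, 'k) two_cat \<Rightarrow> ('o, 'm, 't) two_cat \<Rightarrow> ('i, 'j, 'k, 'o, 'm, 't) two_func \<Rightarrow> bool" where
  "is_two_functor I A F \<longleftrightarrow>
     on0 F \<in> Obj0 I \<rightarrow>\<^sub>E Obj0 A \<and> on1 F \<in> Mor1 I \<rightarrow>\<^sub>E Mor1 A \<and> on2 F \<in> Mor2 I \<rightarrow>\<^sub>E Mor2 A \<and>
     (\<forall>f\<in>Mor1 I. dom1 A (on1 F f) = on0 F (dom1 I f) \<and> cod1 A (on1 F f) = on0 F (cod1 I f)) \<and>
     (\<forall>a\<in>Mor2 I. dom2 A (on2 F a) = on1 F (dom2 I a) \<and> cod2 A (on2 F a) = on1 F (cod2 I a)) \<and>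
     (\<forall>i\<in>Obj0 I. on1 F (id1 I i) = id1 A (on0 F i)) \<and>
     (\<forall>f\<in>Mor1 I. on2 F (id2 I f) = id2 A (on1 F f)) \<and>
     (\<forall>f\<in>Mor1 I. \<forall>g\<in>Mor1 I. dom1 I g = cod1 I f \<longrightarrow>
        on1 F (comp1 I g f) = comp1 A (on1 F g) (on1 F f)) \<and>
     (\<forall>a\<in>Mor2 I. \<forall>b\<in>Mor2 I. dom2 I b = cod2 I a \<longrightarrow>
        on2 F (vcomp I b a) = vcomp A (on2 F b) (on2 F a)) \<and>
     (\<forall>a\<in>Mor2 I. \<forall>b\<in>Mor2 I. dom1 I (dom2 I b) = cod1 I (dom2 I a) \<longrightarrow>
        on2 F (hcomp I b a) = hcomp A (on2 F b) (on2 F a))"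

definition hom_functor ::
  "('i, 'j, 'k) two_cat \<Rightarrow> ('o, 'm, 't) two_cat \<Rightarrow> ('i, 'j, 'k, 'o, 'm, 't) two_func \<Rightarrow>
   'i \<Rightarrow> 'i \<Rightarrow> ('j, 'k, 'm, 't) func" where
  "hom_functor B C T X Y = \<lparr>fdom = hom_cat B X Y, fcod = hom_cat C (on0 T X) (on0 T Y),
     fobj = (\<lambda>f\<in>Obj (hom_cat B X Y). on1 T f), farr = (\<lambda>a\<in>Arr (hom_cat B X Y). on2 T a)\<rparr>"

record ('i, 'j, 'k, 'o, 'm, 't) two_nat =
  tdom :: "('i, 'j, 'k, 'o, 'm, 't) two_func"
  tcod :: "('i, 'j, 'k, 'o, 'm, 't) two_func"
  tcmp :: "'i \<Rightarrow> 'm"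

definition is_two_nat ::
  "('i, 'j, 'k) two_cat \<Rightarrow> ('o, 'm, 't) two_cat \<Rightarrow> ('i, 'j, 'k, 'o, 'm, 't) two_nat \<Rightarrow> bool" where
  "is_two_nat I A u \<longleftrightarrow>
     (let F = tdom u; G = tcod u in
       is_two_functor I A F \<and> is_two_functor I A G \<and>
       tcmp u \<in> Obj0 I \<rightarrow>\<^sub>E Mor1 A \<and>
       (\<forall>i\<in>Obj0 I. dom1 A (tcmp u i) = on0 F i \<and> cod1 A (tcmp u i) = on0 G i) \<and>
       (\<forall>f\<in>Mor1 I. comp1 A (on1 G f) (tcmp u (dom1 I f)) = comp1 A (tcmp u (cod1 I f)) (on1 F f)) \<and>
       (\<forall>a\<in>Mor2 I. hcomp A (on2 G a) (id2 A (tcmp u (dom1 I (dom2 I a)))) =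
                   hcomp A (id2 A (tcmp u (cod1 I (dom2 I a)))) (on2 F a)))"

record ('i, 'j, 'k, 'o, 'm, 't) modif =
  mdom :: "('i, 'j, 'k, 'o, 'm, 't) two_nat"
  mcod :: "('i, 'j, 'k, 'o, 'm, 't) two_nat"
  mcmp :: "'i \<Rightarrow> 't"

definition is_modif ::
  "('i, 'j, 'k) two_cat \<Rightarrow> ('o, 'm, 't) two_cat \<Rightarrow> ('i, 'j, 'k, 'o, 'm, 't) modif \<Rightarrow> bool" where
  "is_modif I A p \<longleftrightarrow>
     (let u = mdom p; v = mcod p; F = tdom u; G = tcod u in
       is_two_nat I A u \<and> is_two_nat I A v \<and> tdom v = F \<and> tcod v = G \<and>
       mcmp p \<in> Obj0 I \<rightarrow>\<^sub>E Mor2 A \<and>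
       (\<forall>i\<in>Obj0 I. dom2 A (mcmp p i) = tcmp u i \<and> cod2 A (mcmp p i) = tcmp v i) \<and>
       (\<forall>f\<in>Mor1 I. hcomp A (id2 A (on1 G f)) (mcmp p (dom1 I f)) =
                   hcomp A (mcmp p (cod1 I f)) (id2 A (on1 F f))))"

text \<open>The 2-category $[I, A]$; all its operations are componentwise.\<close>

definition two_functor_cat ::
  "('i, 'j, 'k) two_cat \<Rightarrow> ('o, 'm, 't) two_cat \<Rightarrow>
   (('i, 'j, 'k, 'o, 'm, 't) two_func, ('i, 'j, 'k, 'o, 'm, 't) two_nat,
    ('i, 'j, 'k, 'o, 'm, 't) modif) two_cat" where
  "two_functor_cat I A = \<lparr>
     Obj0 = {F. is_two_functor I A F},
     Mor1 = {u. is_two_nat I A u},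
     Mor2 = {p. is_modif I A p},
     dom1 = tdom, cod1 = tcod, dom2 = mdom, cod2 = mcod,
     id1 = (\<lambda>F. \<lparr>tdom = F, tcod = F, tcmp = (\<lambda>i\<in>Obj0 I. id1 A (on0 F i))\<rparr>),
     id2 = (\<lambda>u. \<lparr>mdom = u, mcod = u, mcmp = (\<lambda>i\<in>Obj0 I. id2 A (tcmp u i))\<rparr>),
     comp1 = (\<lambda>v u. \<lparr>tdom = tdom u, tcod = tcod v,
       tcmp = (\<lambda>i\<in>Obj0 I. comp1 A (tcmp v i) (tcmp u i))\<rparr>),
     vcomp = (\<lambda>q p. \<lparr>mdom = mdom p, mcod = mcod q,
       mcmp = (\<lambda>i\<in>Obj0 I. vcomp A (mcmp q i) (mcmp p i))\<rparr>),
     hcomp = (\<lambda>q p. \<lparr>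
       mdom = \<lparr>tdom = tdom (mdom p), tcod = tcod (mdom q),
               tcmp = (\<lambda>i\<in>Obj0 I. comp1 A (tcmp (mdom q) i) (tcmp (mdom p) i))\<rparr>,
       mcod = \<lparr>tdom = tdom (mcod p), tcod = tcod (mcod q),
               tcmp = (\<lambda>i\<in>Obj0 I. comp1 A (tcmp (mcod q) i) (tcmp (mcod p) i))\<rparr>,
       mcmp = (\<lambda>i\<in>Obj0 I. hcomp A (mcmp q i) (mcmp p i))\<rparr>)\<rparr>"

definition const_two_functor ::
  "('i, 'j, 'k) two_cat \<Rightarrow> ('o, 'm, 't) two_cat \<Rightarrow> 'o \<Rightarrow> ('i, 'j, 'k, 'o, 'm, 't) two_func" where
  "const_two_functor I A X = \<lparr>on0 = (\<lambda>i\<in>Obj0 I. X), on1 = (\<lambda>f\<in>Mor1 I. id1 A X),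
     on2 = (\<lambda>a\<in>Mor2 I. id2 A (id1 A X))\<rparr>"

definition const_two_nat ::
  "('i, 'j, 'k) two_cat \<Rightarrow> ('o, 'm, 't) two_cat \<Rightarrow> 'm \<Rightarrow> ('i, 'j, 'k, 'o, 'm, 't) two_nat" where
  "const_two_nat I A f = \<lparr>tdom = const_two_functor I A (dom1 A f),
     tcod = const_two_functor I A (cod1 A f), tcmp = (\<lambda>i\<in>Obj0 I. f)\<rparr>"

definition const_modif ::
  "('i, 'j, 'k) two_cat \<Rightarrow> ('o, 'm, 't) two_cat \<Rightarrow> 't \<Rightarrow> ('i, 'j, 'k, 'o, 'm, 't) modif" where
  "const_modif I A a = \<lparr>mdom = const_two_nat I A (dom2 A a),
     mcod = const_two_nat I A (cod2 A a), mcmp = (\<lambda>i\<in>Obj0 I. a)\<rparr>"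

text \<open>The diagonal 2-functor $\Delta : A \to [I, A]$.\<close>

definition diag ::
  "('i, 'j, 'k) two_cat \<Rightarrow> ('o, 'm, 't) two_cat \<Rightarrow>
   ('o, 'm, 't, ('i, 'j, 'k, 'o, 'm, 't) two_func, ('i, 'j, 'k, 'o, 'm, 't) two_nat,
    ('i, 'j, 'k, 'o, 'm, 't) modif) two_func" where
  "diag I A = \<lparr>on0 = (\<lambda>X\<in>Obj0 A. const_two_functor I A X),
     on1 = (\<lambda>f\<in>Mor1 A. const_two_nat I A f), on2 = (\<lambda>a\<in>Mor2 A. const_modif I A a)\<rparr>"


section \<open>2-limits and strict slices\<close>

definition two_cone ::
  "('i, 'j, 'k) two_cat \<Rightarrow> ('o, 'm, 't) two_cat \<Rightarrow> ('i, 'j, 'k, 'o, 'm, 't) two_func \<Rightarrow>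
   'o \<Rightarrow> ('i, 'j, 'k, 'o, 'm, 't) two_nat \<Rightarrow> bool" where
  "two_cone I A F X u \<longleftrightarrow> X \<in> Obj0 A \<and>
     u \<in> Mor1 (two_functor_cat I A) \<and> tdom u = on0 (diag I A) X \<and> tcod u = F"

definition two_limit ::
  "('i, 'j, 'k) two_cat \<Rightarrow> ('o, 'm, 't) two_cat \<Rightarrow> ('i, 'j, 'k, 'o, 'm, 't) two_func \<Rightarrow>
   'o \<times> ('i, 'j, 'k, 'o, 'm, 't) two_nat \<Rightarrow> bool" where
  "two_limit I A F = (\<lambda>(L, l). two_cone I A F L l \<and>
     (\<forall>X\<in>Obj0 A. is_iso_functor
        (comp_functor (post_comp (two_functor_cat I A) (on0 (diag I A) X) l)
                      (hom_functor A (two_functor_cat I A) (diag I A) X L))))"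

text \<open>The strict slice $\Delta \downarrow_s F$. A morphism of it is a triple of its source
  $(X, u)$, its target $(Y, v)$ and a morphism $f$ of $A$, and similarly for 2-morphisms.\<close>

definition strict_slice ::
  "('i, 'j, 'k) two_cat \<Rightarrow> ('o, 'm, 't) two_cat \<Rightarrow> ('i, 'j, 'k, 'o, 'm, 't) two_func \<Rightarrow>
   ('o \<times> ('i, 'j, 'k, 'o, 'm, 't) two_nat,
    ('o \<times> ('i, 'j, 'k, 'o, 'm, 't) two_nat) \<times> ('o \<times> ('i, 'j, 'k, 'o, 'm, 't) two_nat) \<times> 'm,
    ('o \<times> ('i, 'j, 'k, 'o, 'm, 't) two_nat) \<times> ('o \<times> ('i, 'j, 'k, 'o, 'm, 't) two_nat) \<times> 't)
   two_cat" where
  "strict_slice I A F = \<lparr>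
     Obj0 = {(X, u). two_cone I A F X u},
     Mor1 = {((X, u), (Y, v), f). two_cone I A F X u \<and> two_cone I A F Y v \<and>
       f \<in> Mor1 A \<and> dom1 A f = X \<and> cod1 A f = Y \<and>
       comp1 (two_functor_cat I A) v (on1 (diag I A) f) = u},
     Mor2 = {((X, u), (Y, v), a). two_cone I A F X u \<and> two_cone I A F Y v \<and>
       a \<in> Mor2 A \<and> dom1 A (dom2 A a) = X \<and> cod1 A (dom2 A a) = Y \<and>
       comp1 (two_functor_cat I A) v (on1 (diag I A) (dom2 A a)) = u \<and>
       comp1 (two_functor_cat I A) v (on1 (diag I A) (cod2 A a)) = u \<and>
       hcomp (two_functor_cat I A) (id2 (two_functor_cat I A) v) (on2 (diag I A) a) =
         id2 (two_functor_cat I A) u},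
     dom1 = (\<lambda>(x, y, f). x), cod1 = (\<lambda>(x, y, f). y),
     dom2 = (\<lambda>(x, y, a). (x, y, dom2 A a)), cod2 = (\<lambda>(x, y, a). (x, y, cod2 A a)),
     id1 = (\<lambda>x. (x, x, id1 A (fst x))),
     id2 = (\<lambda>(x, y, f). (x, y, id2 A f)),
     comp1 = (\<lambda>(y, z, g) (x, y', f). (x, z, comp1 A g f)),
     vcomp = (\<lambda>(x, y, b) (x', y', a). (x, y, vcomp A b a)),
     hcomp = (\<lambda>(y, z, b) (x, y', a). (x, z, hcomp A b a))\<rparr>"


section \<open>The 2-category of small categories\<close>

text \<open>The type \<open>'u\<close> plays the role of the universe, and a set of elements of \<open>'u\<close> is small if it
  has smaller cardinality than \<open>'u\<close>. If \<open>'u\<close> has the cardinality of a Grothendieck universe $U$,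
  then a bijection between the two identifies the small subsets of \<open>'u\<close> with the elements of $U$
  (for inaccessible $\kappa$, the elements of $V_\kappa$ are exactly its subsets of cardinality
  below $\kappa$), so this is the usual notion of smallness. Instead of
  inaccessibility it suffices to assume \<open>'u\<close> infinite: small sets are then closed under binary
  products and sums.\<close>

definition small_set :: "'u set \<Rightarrow> bool" where
  "small_set S \<longleftrightarrow> (card_of S, card_of (UNIV :: 'u set)) \<in> ordLess"

definition small_category :: "('u, 'u) cat \<Rightarrow> bool" where
  "small_category C \<longleftrightarrow> category C \<and> small_set (Obj C) \<and> small_set (Arr C) \<and>
     Dom C \<in> extensional (Arr C) \<and> Cod C \<in> extensional (Arr C) \<and>
     Ident C \<in> extensional (Obj C) \<and>
     (\<forall>g f. \<not> (g \<in> Arr C \<and> f \<in> Arr C \<and> Dom C g = Cod C f) \<longrightarrow> Comp C g f = undefined)"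

definition Cat ::
  "(('u, 'u) cat, ('u, 'u, 'u, 'u) func, ('u, 'u, 'u, 'u) ntrans) two_cat" where
  "Cat = \<lparr>
     Obj0 = {C. small_category C},
     Mor1 = {F. is_functor F \<and> small_category (fdom F) \<and> small_category (fcod F)},
     Mor2 = {t. is_ntrans t \<and> small_category (fdom (ndom t)) \<and> small_category (fcod (ndom t))},
     dom1 = fdom, cod1 = fcod, dom2 = ndom, cod2 = ncod,
     id1 = id_functor, id2 = id_ntrans,
     comp1 = comp_functor, vcomp = vcomp_ntrans, hcomp = hcomp_ntrans\<rparr>"

end

theory Submission
  imports Defs
begin

text \<open>A 2-terminal object of the strict slice only supplies, for every cone, a unique mediating
  morphism, so it has to be shown that this 1-dimensional property forces the 2-dimensional one. In
  \<open>Cat\<close> this works because 2-morphisms are themselves morphisms: a natural transformation between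
  functors $X \to Y$ is a functor $X \times \mathbf{2} \to Y$. Hence a modification between cones
  with vertex $X$ is a cone with vertex $X \times \mathbf{2}$, and its unique mediating functor is the
  required unique 2-morphism into the limit.\<close>

section \<open>Functors and isomorphisms of categories\<close>

text \<open>The slice hides most of the 2-dimensional data. Its 2-morphisms are only those that
  whisker with the cone to an identity, so having a single one of them says nothing directly about
  modifications between different cones. This is why cylinders appear as a hypothesis of the
  abstract argument: it is carried out in an arbitrary 2-category \<open>A\<close>, and
  \<open>Cat\<close> enters through the existence of cylinders. In \<open>Cat\<close> the difficulty
  is typing and size. Objects and arrows of a small category share the type \<open>'u\<close>, so
  the product with the arrow category has to be coded back into \<open>'u\<close>. Infinity of
  \<open>'u\<close> supplies both the coding injection and the smallness of the coded
  category.\<close>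

lemma categoryD:
  assumes "category C"
  shows "f \<in> Arr C \<Longrightarrow> Dom C f \<in> Obj C" "f \<in> Arr C \<Longrightarrow> Cod C f \<in> Obj C"
    and "x \<in> Obj C \<Longrightarrow> Ident C x \<in> Arr C" "x \<in> Obj C \<Longrightarrow> Dom C (Ident C x) = x"
      "x \<in> Obj C \<Longrightarrow> Cod C (Ident C x) = x"
    and "\<lbrakk>f \<in> Arr C; g \<in> Arr C; Dom C g = Cod C f\<rbrakk> \<Longrightarrow> Comp C g f \<in> Arr C"
      "\<lbrakk>f \<in> Arr C; g \<in> Arr C; Dom C g = Cod C f\<rbrakk> \<Longrightarrow> Dom C (Comp C g f) = Dom C f"
      "\<lbrakk>f \<in> Arr C; g \<in> Arr C; Dom C g = Cod C f\<rbrakk> \<Longrightarrow> Cod C (Comp C g f) = Cod C g"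
    and "\<lbrakk>f \<in> Arr C; Dom C f = x\<rbrakk> \<Longrightarrow> Comp C f (Ident C x) = f"
      "\<lbrakk>f \<in> Arr C; Cod C f = x\<rbrakk> \<Longrightarrow> Comp C (Ident C x) f = f"
    and "\<lbrakk>f \<in> Arr C; g \<in> Arr C; h \<in> Arr C; Dom C g = Cod C f; Dom C h = Cod C g\<rbrakk> \<Longrightarrow>
      Comp C (Comp C h g) f = Comp C h (Comp C g f)"
  using assms unfolding category_def by auto

lemma is_functorD:
  assumes "is_functor F"
  shows "category (fdom F)" "category (fcod F)"
    and "x \<in> Obj (fdom F) \<Longrightarrow> fobj F x \<in> Obj (fcod F)"
      "f \<in> Arr (fdom F) \<Longrightarrow> farr F f \<in> Arr (fcod F)"
    and "fobj F \<in> extensional (Obj (fdom F))" "farr F \<in> extensional (Arr (fdom F))"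
    and "f \<in> Arr (fdom F) \<Longrightarrow> Dom (fcod F) (farr F f) = fobj F (Dom (fdom F) f)"
      "f \<in> Arr (fdom F) \<Longrightarrow> Cod (fcod F) (farr F f) = fobj F (Cod (fdom F) f)"
    and "x \<in> Obj (fdom F) \<Longrightarrow> farr F (Ident (fdom F) x) = Ident (fcod F) (fobj F x)"
    and "\<lbrakk>f \<in> Arr (fdom F); g \<in> Arr (fdom F); Dom (fdom F) g = Cod (fdom F) f\<rbrakk> \<Longrightarrow>
      farr F (Comp (fdom F) g f) = Comp (fcod F) (farr F g) (farr F f)"
  using assms unfolding is_functor_def by (auto simp: PiE_def Pi_def)

lemma is_functorI:
  assumes "category (fdom F)" "category (fcod F)"
    and "\<And>x. x \<in> Obj (fdom F) \<Longrightarrow> fobj F x \<in> Obj (fcod F)"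
      "\<And>f. f \<in> Arr (fdom F) \<Longrightarrow> farr F f \<in> Arr (fcod F)"
    and "fobj F \<in> extensional (Obj (fdom F))" "farr F \<in> extensional (Arr (fdom F))"
    and "\<And>f. f \<in> Arr (fdom F) \<Longrightarrow> Dom (fcod F) (farr F f) = fobj F (Dom (fdom F) f)"
      "\<And>f. f \<in> Arr (fdom F) \<Longrightarrow> Cod (fcod F) (farr F f) = fobj F (Cod (fdom F) f)"
    and "\<And>x. x \<in> Obj (fdom F) \<Longrightarrow> farr F (Ident (fdom F) x) = Ident (fcod F) (fobj F x)"
    and "\<And>f g. \<lbrakk>f \<in> Arr (fdom F); g \<in> Arr (fdom F); Dom (fdom F) g = Cod (fdom F) f\<rbrakk> \<Longrightarrow>
      farr F (Comp (fdom F) g f) = Comp (fcod F) (farr F g) (farr F f)"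
  shows "is_functor F"
  using assms unfolding is_functor_def by (auto simp: PiE_def)

lemma func_eqI:
  fixes F G :: "('o, 'a, 'p, 'b) func"
  assumes "is_functor F" "is_functor G" "fdom F = fdom G" "fcod F = fcod G"
    and "\<And>x. x \<in> Obj (fdom G) \<Longrightarrow> fobj F x = fobj G x"
    and "\<And>f. f \<in> Arr (fdom G) \<Longrightarrow> farr F f = farr G f"
  shows "F = G"
proof -
  note D = is_functorD[OF assms(1)] is_functorD[OF assms(2)]
  have "fobj F = fobj G"
    by (rule extensionalityI[of _ "Obj (fdom G)"]) (use assms(3-6) D in auto)
  moreover have "farr F = farr G"
    by (rule extensionalityI[of _ "Arr (fdom G)"]) (use assms(3-6) D in auto)
  ultimately show ?thesis using assms by simp
qed

text \<open>This splits the 2-limit property into a bijection on cones and a bijection on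
  modifications, which are proved separately. The inverse maps respect sources, targets, identities
  and composites because both sides of each such equation have the same image under the injective
  maps of \<open>F\<close>.\<close>

lemma is_iso_functor_iff_bij_betw:
  "is_iso_functor F \<longleftrightarrow> is_functor F \<and> bij_betw (fobj F) (Obj (fdom F)) (Obj (fcod F)) \<and>
     bij_betw (farr F) (Arr (fdom F)) (Arr (fcod F))"
proof (intro iffI conjI; (elim conjE)?)
  assume F: "is_iso_functor F"
  then show fF: "is_functor F" by (simp add: is_iso_functor_def)
  from F obtain G where G: "is_functor G" "fdom G = fcod F" "fcod G = fdom F"
    and GF: "comp_functor G F = id_functor (fdom F)" and FG: "comp_functor F G = id_functor (fcod F)"
    unfolding is_iso_functor_def by blast
  note D = is_functorD[OF fF] is_functorD[OF G(1), unfolded G]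
  have "fobj G (fobj F x) = x" if "x \<in> Obj (fdom F)" for x
    using fun_cong[OF arg_cong[OF GF, of fobj], of x] that by (simp add: comp_functor_def id_functor_def)
  moreover have "fobj F (fobj G x) = x" if "x \<in> Obj (fcod F)" for x
    using fun_cong[OF arg_cong[OF FG, of fobj], of x] that G by (simp add: comp_functor_def id_functor_def)
  ultimately show "bij_betw (fobj F) (Obj (fdom F)) (Obj (fcod F))"
    by (intro bij_betw_byWitness[where f' = "fobj G"]) (use D in auto)
  have "farr G (farr F x) = x" if "x \<in> Arr (fdom F)" for x
    using fun_cong[OF arg_cong[OF GF, of farr], of x] that by (simp add: comp_functor_def id_functor_def)
  moreover have "farr F (farr G x) = x" if "x \<in> Arr (fcod F)" for x
    using fun_cong[OF arg_cong[OF FG, of farr], of x] that G by (simp add: comp_functor_def id_functor_def)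
  ultimately show "bij_betw (farr F) (Arr (fdom F)) (Arr (fcod F))"
    by (intro bij_betw_byWitness[where f' = "farr G"]) (use D in auto)
next
  assume fF: "is_functor F" and o: "bij_betw (fobj F) (Obj (fdom F)) (Obj (fcod F))"
    and a: "bij_betw (farr F) (Arr (fdom F)) (Arr (fcod F))"
  define go where "go = the_inv_into (Obj (fdom F)) (fobj F)"
  define ga where "ga = the_inv_into (Arr (fdom F)) (farr F)"
  define G where "G = \<lparr>fdom = fcod F, fcod = fdom F, fobj = restrict go (Obj (fcod F)),
    farr = restrict ga (Arr (fcod F))\<rparr>"
  note D = is_functorD[OF fF] categoryD[OF is_functorD(1)[OF fF]] categoryD[OF is_functorD(2)[OF fF]]
  have go: "go x \<in> Obj (fdom F)" "fobj F (go x) = x" if "x \<in> Obj (fcod F)" for x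
    using that o by (auto simp: go_def bij_betw_def the_inv_into_into f_the_inv_into_f)
  have ga: "ga x \<in> Arr (fdom F)" "farr F (ga x) = x" if "x \<in> Arr (fcod F)" for x
    using that a by (auto simp: ga_def bij_betw_def the_inv_into_into f_the_inv_into_f)
  have go': "go y = x" if "x \<in> Obj (fdom F)" "fobj F x = y" for x y
    using that o by (auto simp: go_def bij_betw_def the_inv_into_f_f)
  have ga': "ga y = x" if "x \<in> Arr (fdom F)" "farr F x = y" for x y
    using that a by (auto simp: ga_def bij_betw_def the_inv_into_f_f)
  have dg: "Dom (fdom F) (ga f) = go (Dom (fcod F) f)" "Cod (fdom F) (ga f) = go (Cod (fcod F) f)"
    if "f \<in> Arr (fcod F)" for f
    using ga[OF that] D(7,8)[of "ga f"] by (auto intro!: go'[symmetric] D)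
  have "is_functor G"
    by (rule is_functorI) (auto simp: G_def D go ga dg intro!: ga')
  moreover have "comp_functor G F = id_functor (fdom F)" "comp_functor F G = id_functor (fcod F)"
    by (auto simp: comp_functor_def id_functor_def G_def D go go' ga ga' restrict_def fun_eq_iff)
  ultimately show "is_iso_functor F"
    unfolding is_iso_functor_def using fF by (auto simp: G_def)
qed

text \<open>2-terminality becomes a matter of counting the morphisms and 2-morphisms in the
  hom-categories of the slice.\<close>

lemma isomorphic_terminal_cat_iff:
  "isomorphic_cats C terminal_cat \<longleftrightarrow> category C \<and> (\<exists>x. Obj C = {x}) \<and> (\<exists>f. Arr C = {f})"
proof
  assume "isomorphic_cats C terminal_cat"
  then obtain F where F: "is_iso_functor F" "fdom F = C" "fcod F = terminal_cat"
    unfolding isomorphic_cats_def by blast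
  then have "is_functor F" "bij_betw (fobj F) (Obj C) {()}" "bij_betw (farr F) (Arr C) {()}"
    by (auto simp: is_iso_functor_iff_bij_betw terminal_cat_def)
  then show "category C \<and> (\<exists>x. Obj C = {x}) \<and> (\<exists>f. Arr C = {f})"
    using F(2) is_functorD(1)[of F]
    by (auto simp: card_1_singleton_iff[symmetric] dest!: bij_betw_same_card)
next
  assume C: "category C \<and> (\<exists>x. Obj C = {x}) \<and> (\<exists>f. Arr C = {f})"
  then obtain x f where xf: "Obj C = {x}" "Arr C = {f}" by blast
  define F where "F = \<lparr>fdom = C, fcod = terminal_cat, fobj = (\<lambda>x\<in>Obj C. ()), farr = (\<lambda>f\<in>Arr C. ())\<rparr>"
  have "category terminal_cat"
    by (simp add: category_def terminal_cat_def)
  then have "is_functor F"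
    using C by (intro is_functorI) (auto simp: F_def terminal_cat_def)
  then have "is_iso_functor F"
    unfolding is_iso_functor_iff_bij_betw
    by (auto simp: F_def terminal_cat_def xf bij_betw_def)
  then show "isomorphic_cats C terminal_cat"
    unfolding isomorphic_cats_def by (auto simp: F_def)
qed

section \<open>2-natural transformations and modifications\<close>

locale strict_two_category =
  fixes A :: "('o, 'm, 't) two_cat"
  assumes two_category: "two_category A"
begin

lemma category_0_1: "category \<lparr>Obj = Obj0 A, Arr = Mor1 A, Dom = dom1 A, Cod = cod1 A,
    Ident = id1 A, Comp = comp1 A\<rparr>"
  and category_1_2: "category \<lparr>Obj = Mor1 A, Arr = Mor2 A, Dom = dom2 A, Cod = cod2 A,
    Ident = id2 A, Comp = vcomp A\<rparr>"
  and category_0_2: "category \<lparr>Obj = Obj0 A, Arr = Mor2 A, Dom = (\<lambda>a. dom1 A (dom2 A a)),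
    Cod = (\<lambda>a. cod1 A (dom2 A a)), Ident = (\<lambda>x. id2 A (id1 A x)), Comp = hcomp A\<rparr>"
  using two_category by (simp_all add: two_category_def)

lemmas one_cell_simps [simp] = categoryD(1-8)[OF category_0_1, simplified]
lemmas comp1_assoc = categoryD(11)[OF category_0_1, simplified]
lemmas vertical_simps [simp] = categoryD(1-10)[OF category_1_2, simplified]
lemmas vcomp_assoc = categoryD(11)[OF category_1_2, simplified]
lemmas horizontal_simps = categoryD[OF category_0_2, simplified]

lemmas comp1_id1 [simp] = categoryD(9,10)[OF category_0_1, simplified]

lemma boundary_simps [simp]:
  "a \<in> Mor2 A \<Longrightarrow> dom1 A (cod2 A a) = dom1 A (dom2 A a)"
  "a \<in> Mor2 A \<Longrightarrow> cod1 A (cod2 A a) = cod1 A (dom2 A a)"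
  using two_category by (simp_all add: two_category_def)

lemma hcomp_simps [simp]:
  assumes "a \<in> Mor2 A" "b \<in> Mor2 A" "dom1 A (dom2 A b) = cod1 A (dom2 A a)"
  shows "hcomp A b a \<in> Mor2 A"
    and "dom2 A (hcomp A b a) = comp1 A (dom2 A b) (dom2 A a)"
    and "cod2 A (hcomp A b a) = comp1 A (cod2 A b) (cod2 A a)"
  using assms two_category horizontal_simps by (simp_all add: two_category_def)

lemma hcomp_id2_id2 [simp]:
  "\<lbrakk>f \<in> Mor1 A; g \<in> Mor1 A; dom1 A g = cod1 A f\<rbrakk> \<Longrightarrow>
    hcomp A (id2 A g) (id2 A f) = id2 A (comp1 A g f)"
  using two_category by (simp add: two_category_def)

lemma hcomp_assoc:
  "\<lbrakk>a \<in> Mor2 A; b \<in> Mor2 A; c \<in> Mor2 A; dom1 A (dom2 A b) = cod1 A (dom2 A a);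
    dom1 A (dom2 A c) = cod1 A (dom2 A b)\<rbrakk> \<Longrightarrow>
    hcomp A (hcomp A c b) a = hcomp A c (hcomp A b a)"
  using horizontal_simps by simp

lemma whisker_assoc:
  "\<lbrakk>a \<in> Mor2 A; b \<in> Mor1 A; c \<in> Mor1 A; dom1 A b = cod1 A (dom2 A a); dom1 A c = cod1 A b\<rbrakk> \<Longrightarrow>
    hcomp A (id2 A c) (hcomp A (id2 A b) a) = hcomp A (id2 A (comp1 A c b)) a"
  by (simp add: hcomp_assoc[symmetric])

lemma hcomp_id2_id1 [simp]:
  "\<lbrakk>a \<in> Mor2 A; dom1 A (dom2 A a) = x\<rbrakk> \<Longrightarrow> hcomp A a (id2 A (id1 A x)) = a"
  "\<lbrakk>a \<in> Mor2 A; cod1 A (dom2 A a) = x\<rbrakk> \<Longrightarrow> hcomp A (id2 A (id1 A x)) a = a"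
  using horizontal_simps by auto

lemma interchange:
  "\<lbrakk>a \<in> Mor2 A; a' \<in> Mor2 A; b \<in> Mor2 A; b' \<in> Mor2 A; dom2 A a' = cod2 A a; dom2 A b' = cod2 A b;
    dom1 A (dom2 A b) = cod1 A (dom2 A a)\<rbrakk> \<Longrightarrow>
    hcomp A (vcomp A b' b) (vcomp A a' a) = vcomp A (hcomp A b' a') (hcomp A b a)"
  using two_category by (simp add: two_category_def)

lemma category_hom_cat: "category (hom_cat A X Y)"
  by (auto simp: category_def hom_cat_def vcomp_assoc)

end

section \<open>Rules for 2-functors, 2-natural transformations and modifications\<close>

lemma is_two_functorD:
  assumes "is_two_functor I A F"
  shows "i \<in> Obj0 I \<Longrightarrow> on0 F i \<in> Obj0 A" "f \<in> Mor1 I \<Longrightarrow> on1 F f \<in> Mor1 A"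
      "a \<in> Mor2 I \<Longrightarrow> on2 F a \<in> Mor2 A"
    and "f \<in> Mor1 I \<Longrightarrow> dom1 A (on1 F f) = on0 F (dom1 I f)"
      "f \<in> Mor1 I \<Longrightarrow> cod1 A (on1 F f) = on0 F (cod1 I f)"
    and "a \<in> Mor2 I \<Longrightarrow> dom2 A (on2 F a) = on1 F (dom2 I a)"
      "a \<in> Mor2 I \<Longrightarrow> cod2 A (on2 F a) = on1 F (cod2 I a)"
  using assms unfolding is_two_functor_def by (auto simp: PiE_def Pi_def)

lemma is_two_natD:
  assumes "is_two_nat I A u"
  shows "is_two_functor I A (tdom u)" "is_two_functor I A (tcod u)"
    and "i \<in> Obj0 I \<Longrightarrow> tcmp u i \<in> Mor1 A"
      "tcmp u \<in> extensional (Obj0 I)"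
    and "i \<in> Obj0 I \<Longrightarrow> dom1 A (tcmp u i) = on0 (tdom u) i"
      "i \<in> Obj0 I \<Longrightarrow> cod1 A (tcmp u i) = on0 (tcod u) i"
    and "f \<in> Mor1 I \<Longrightarrow>
      comp1 A (on1 (tcod u) f) (tcmp u (dom1 I f)) = comp1 A (tcmp u (cod1 I f)) (on1 (tdom u) f)"
    and "a \<in> Mor2 I \<Longrightarrow> hcomp A (on2 (tcod u) a) (id2 A (tcmp u (dom1 I (dom2 I a)))) =
      hcomp A (id2 A (tcmp u (cod1 I (dom2 I a)))) (on2 (tdom u) a)"
  using assms unfolding is_two_nat_def Let_def by (auto simp: PiE_def Pi_def)

lemma is_two_natI:
  assumes "is_two_functor I A (tdom u)" "is_two_functor I A (tcod u)"
    and "\<And>i. i \<in> Obj0 I \<Longrightarrow> tcmp u i \<in> Mor1 A"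
      "tcmp u \<in> extensional (Obj0 I)"
    and "\<And>i. i \<in> Obj0 I \<Longrightarrow> dom1 A (tcmp u i) = on0 (tdom u) i"
      "\<And>i. i \<in> Obj0 I \<Longrightarrow> cod1 A (tcmp u i) = on0 (tcod u) i"
    and "\<And>f. f \<in> Mor1 I \<Longrightarrow>
      comp1 A (on1 (tcod u) f) (tcmp u (dom1 I f)) = comp1 A (tcmp u (cod1 I f)) (on1 (tdom u) f)"
    and "\<And>a. a \<in> Mor2 I \<Longrightarrow> hcomp A (on2 (tcod u) a) (id2 A (tcmp u (dom1 I (dom2 I a)))) =
      hcomp A (id2 A (tcmp u (cod1 I (dom2 I a)))) (on2 (tdom u) a)"
  shows "is_two_nat I A u"
  using assms unfolding is_two_nat_def Let_def by (auto simp: PiE_def)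

lemma two_nat_eqI:
  fixes u v :: "('i, 'j, 'k, 'o, 'm, 't) two_nat"
  assumes "is_two_nat I A u" "is_two_nat I A v" "tdom u = tdom v" "tcod u = tcod v"
    and "\<And>i. i \<in> Obj0 I \<Longrightarrow> tcmp u i = tcmp v i"
  shows "u = v"
proof -
  have "tcmp u = tcmp v"
    by (rule extensionalityI[of _ "Obj0 I"])
      (use assms is_two_natD(4)[OF assms(1)] is_two_natD(4)[OF assms(2)] in auto)
  then show ?thesis using assms by simp
qed

lemma is_modifD:
  assumes "is_modif I A p"
  shows "is_two_nat I A (mdom p)" "is_two_nat I A (mcod p)"
      "tdom (mcod p) = tdom (mdom p)" "tcod (mcod p) = tcod (mdom p)"
    and "i \<in> Obj0 I \<Longrightarrow> mcmp p i \<in> Mor2 A" "mcmp p \<in> extensional (Obj0 I)"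
    and "i \<in> Obj0 I \<Longrightarrow> dom2 A (mcmp p i) = tcmp (mdom p) i"
      "i \<in> Obj0 I \<Longrightarrow> cod2 A (mcmp p i) = tcmp (mcod p) i"
    and "f \<in> Mor1 I \<Longrightarrow> hcomp A (id2 A (on1 (tcod (mdom p)) f)) (mcmp p (dom1 I f)) =
      hcomp A (mcmp p (cod1 I f)) (id2 A (on1 (tdom (mdom p)) f))"
  using assms unfolding is_modif_def Let_def by (auto simp: PiE_def Pi_def)

lemma is_modifI:
  assumes "is_two_nat I A (mdom p)" "is_two_nat I A (mcod p)"
      "tdom (mcod p) = tdom (mdom p)" "tcod (mcod p) = tcod (mdom p)"
    and "\<And>i. i \<in> Obj0 I \<Longrightarrow> mcmp p i \<in> Mor2 A" "mcmp p \<in> extensional (Obj0 I)"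
    and "\<And>i. i \<in> Obj0 I \<Longrightarrow> dom2 A (mcmp p i) = tcmp (mdom p) i"
      "\<And>i. i \<in> Obj0 I \<Longrightarrow> cod2 A (mcmp p i) = tcmp (mcod p) i"
    and "\<And>f. f \<in> Mor1 I \<Longrightarrow> hcomp A (id2 A (on1 (tcod (mdom p)) f)) (mcmp p (dom1 I f)) =
      hcomp A (mcmp p (cod1 I f)) (id2 A (on1 (tdom (mdom p)) f))"
  shows "is_modif I A p"
  using assms unfolding is_modif_def Let_def by (auto simp: PiE_def)

lemma modif_eqI:
  fixes p q :: "('i, 'j, 'k, 'o, 'm, 't) modif"
  assumes "is_modif I A p" "is_modif I A q" "mdom p = mdom q" "mcod p = mcod q"
    and "\<And>i. i \<in> Obj0 I \<Longrightarrow> mcmp p i = mcmp q i"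
  shows "p = q"
proof -
  have "mcmp p = mcmp q"
    by (rule extensionalityI[of _ "Obj0 I"])
      (use assms is_modifD(6)[OF assms(1)] is_modifD(6)[OF assms(2)] in auto)
  then show ?thesis using assms by simp
qed

section \<open>Operations and hom-categories of the 2-category $[I, A]$\<close>

locale two_category_pair =
  I: strict_two_category I + A: strict_two_category A
  for I :: "('i, 'j, 'k) two_cat" and A :: "('o, 'm, 't) two_cat"
begin

abbreviation FC where "FC \<equiv> two_functor_cat I A"

lemmas FC_def = two_functor_cat_def

lemma FC_simps:
  "u \<in> Mor1 FC \<longleftrightarrow> is_two_nat I A u" "p \<in> Mor2 FC \<longleftrightarrow> is_modif I A p"
  "dom1 FC = tdom" "cod1 FC = tcod" "dom2 FC = mdom" "cod2 FC = mcod"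
  "mdom (id2 FC u) = u" "mcod (id2 FC u) = u"
  "mdom (vcomp FC q p) = mdom p" "mcod (vcomp FC q p) = mcod q"
  by (simp_all add: FC_def)

lemma is_two_nat_comp1:
  assumes u: "is_two_nat I A u" and v: "is_two_nat I A v" and uv: "tdom v = tcod u"
  shows "is_two_nat I A (comp1 FC v u)"
proof -
  note U = is_two_natD[OF u] and V = is_two_natD[OF v, unfolded uv]
  note F = is_two_functorD[OF U(1)] is_two_functorD[OF U(2)] is_two_functorD[OF V(2)]
  show ?thesis
  proof (rule is_two_natI, goal_cases)
    \<comment> \<open>Naturality at morphisms, and in case 8 at 2-morphisms, pastes the squares of
      \<open>v\<close> and \<open>u\<close>. \<open>U(1-6)\<close> and \<open>V(1-6)\<close> leave
      the naturality equations out, so that after the first reassociation each step applies those of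
      exactly one of the two.\<close>
    case (7 f)
    let ?s = "dom1 I f" and ?t = "cod1 I f"
    have "comp1 A (on1 (tcod v) f) (comp1 A (tcmp v ?s) (tcmp u ?s)) =
      comp1 A (comp1 A (on1 (tcod v) f) (tcmp v ?s)) (tcmp u ?s)"
      using 7 by (simp add: U(1-6) V(1-6) F A.comp1_assoc)
    also have "\<dots> = comp1 A (tcmp v ?t) (comp1 A (on1 (tcod u) f) (tcmp u ?s))"
      using 7 by (simp add: U(1-6) V F A.comp1_assoc)
    also have "\<dots> = comp1 A (comp1 A (tcmp v ?t) (tcmp u ?t)) (on1 (tdom u) f)"
      using 7 by (simp add: U V(1-6) F A.comp1_assoc)
    finally show ?case
      using 7 by (simp add: FC_def)
  next
    case (8 a)
    let ?s = "dom1 I (dom2 I a)" and ?t = "cod1 I (dom2 I a)"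
    have "hcomp A (on2 (tcod v) a) (id2 A (comp1 A (tcmp v ?s) (tcmp u ?s))) =
      hcomp A (hcomp A (on2 (tcod v) a) (id2 A (tcmp v ?s))) (id2 A (tcmp u ?s))"
      using 8 by (simp add: U(1-6) V(1-6) F A.hcomp_assoc)
    also have "\<dots> = hcomp A (id2 A (tcmp v ?t)) (hcomp A (on2 (tcod u) a) (id2 A (tcmp u ?s)))"
      using 8 by (simp add: U(1-6) V F A.hcomp_assoc)
    also have "\<dots> = hcomp A (id2 A (comp1 A (tcmp v ?t) (tcmp u ?t))) (on2 (tdom u) a)"
      using 8 by (simp add: U V(1-6) F A.whisker_assoc)
    finally show ?case
      using 8 by (simp add: FC_def)
  qed (use U(1-6) V(1-6) F in \<open>auto simp: FC_def\<close>)
qed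

lemma is_modif_hcomp:
  assumes p: "is_modif I A p" and q: "is_modif I A q" and pq: "tdom (mdom q) = tcod (mdom p)"
  shows "is_modif I A (hcomp FC q p)"
proof -
  note P = is_modifD[OF p] and Q = is_modifD[OF q, unfolded pq]
  note U = is_two_natD[OF P(1)] and V = is_two_natD[OF Q(1), unfolded pq]
  note F = is_two_functorD[OF U(1)] is_two_functorD[OF U(2)] is_two_functorD[OF V(2)]
  have *: "is_two_nat I A (comp1 FC (mdom q) (mdom p))" "is_two_nat I A (comp1 FC (mcod q) (mcod p))"
    using P Q pq by (auto intro!: is_two_nat_comp1)
  note S = P(3-8) Q(3-8) U(1-6) V(1-6) F
  show ?thesis
  proof (rule is_modifI, goal_cases)
    case (9 f)
    let ?s = "dom1 I f" and ?t = "cod1 I f"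
    have "hcomp A (id2 A (on1 (tcod (mdom q)) f)) (hcomp A (mcmp q ?s) (mcmp p ?s)) =
      hcomp A (hcomp A (id2 A (on1 (tcod (mdom q)) f)) (mcmp q ?s)) (mcmp p ?s)"
      using 9 by (simp add: S A.hcomp_assoc)
    also have "\<dots> = hcomp A (mcmp q ?t) (hcomp A (id2 A (on1 (tcod (mdom p)) f)) (mcmp p ?s))"
      using 9 by (simp add: S Q(9) A.hcomp_assoc)
    also have "\<dots> = hcomp A (hcomp A (mcmp q ?t) (mcmp p ?t)) (id2 A (on1 (tdom (mdom p)) f))"
      using 9 by (simp add: S P(9) A.hcomp_assoc)
    finally show ?case
      using 9 by (simp add: FC_def)
  qed (use * P Q pq U V in \<open>auto simp: FC_def\<close>)
qed

lemma is_modif_id2: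
  assumes u: "is_two_nat I A u"
  shows "is_modif I A (id2 FC u)"
proof -
  note U = is_two_natD[OF u]
  note F = is_two_functorD[OF U(1)] is_two_functorD[OF U(2)]
  show ?thesis
    by (rule is_modifI) (use u U F in \<open>auto simp: FC_def\<close>)
qed

lemma is_modif_vcomp:
  assumes p: "is_modif I A p" and q: "is_modif I A q" and pq: "mdom q = mcod p"
  shows "is_modif I A (vcomp FC q p)"
proof -
  note P = is_modifD[OF p] and Q = is_modifD[OF q, unfolded pq]
  note U = is_two_natD[OF P(1)] and V = is_two_natD[OF P(2)] and W = is_two_natD[OF Q(2)]
  note F = is_two_functorD[OF U(1)] is_two_functorD[OF U(2)]
  note S = P(3-8) Q(3-8) U(1-6) V(1-6) W(1-6) F
  show ?thesis
  proof (rule is_modifI, goal_cases)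
    case (9 f)
    let ?s = "dom1 I f" and ?t = "cod1 I f"
    let ?F = "id2 A (on1 (tdom (mdom p)) f)" and ?G = "id2 A (on1 (tcod (mdom p)) f)"
    \<comment> \<open>Interchange lets whiskering distribute over vertical composition once the
      identity \<open>?G\<close> is written as the composite \<open>vcomp A ?G ?G\<close>; the same
      trick with \<open>?F\<close> leads back.\<close>
    have "hcomp A (vcomp A ?G ?G) (vcomp A (mcmp q ?s) (mcmp p ?s)) =
      vcomp A (hcomp A ?G (mcmp q ?s)) (hcomp A ?G (mcmp p ?s))"
      using 9 by (intro A.interchange) (simp_all add: S)
    also have "\<dots> = vcomp A (hcomp A (mcmp q ?t) ?F) (hcomp A (mcmp p ?t) ?F)"
      using 9 P(9)[OF 9] Q(9)[OF 9] by (simp add: S)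
    also have "\<dots> = hcomp A (vcomp A (mcmp q ?t) (mcmp p ?t)) (vcomp A ?F ?F)"
      using 9 by (intro A.interchange[symmetric]) (simp_all add: S)
    finally show ?case
      using 9 by (simp add: FC_def S)
  qed (use P Q pq U V W in \<open>auto simp: FC_def\<close>)
qed

text \<open>Needed for the codomain of the comparison functor. The laws hold componentwise in
  \<open>A\<close>.\<close>

lemma category_hom_cat_FC: "category (hom_cat FC G H)"
proof -
  have vid: "vcomp FC p (id2 FC (mdom p)) = p" "vcomp FC (id2 FC (mcod p)) p = p"
    if "is_modif I A p" for p
  proof -
    note P = is_modifD[OF that]
    note U = is_two_natD[OF P(1)] and V = is_two_natD[OF P(2)]
    show "vcomp FC p (id2 FC (mdom p)) = p"
      by (rule modif_eqI[where I = I and A = A])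
        (use is_modif_vcomp[of "id2 FC (mdom p)" p] that is_modif_id2 P U V in \<open>simp_all add: FC_def\<close>)
    show "vcomp FC (id2 FC (mcod p)) p = p"
      by (rule modif_eqI[where I = I and A = A])
        (use is_modif_vcomp[of p "id2 FC (mcod p)"] that is_modif_id2 P U V in \<open>simp_all add: FC_def\<close>)
  qed
  have vassoc: "vcomp FC r (vcomp FC q p) = vcomp FC (vcomp FC r q) p"
    if "is_modif I A p" "is_modif I A q" "is_modif I A r" "mdom q = mcod p" "mdom r = mcod q" for p q r
    using is_modifD[OF that(1)] is_modifD[OF that(2)] is_modifD[OF that(3)] that(4,5)
    by (auto simp: FC_def fun_eq_iff restrict_def A.vcomp_assoc)
  show ?thesis
    unfolding category_def hom_cat_def
    by (auto simp: vid vassoc FC_simps is_modif_id2 is_modif_vcomp is_modifD)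
qed

lemma const_two_functor_simps:
  "i \<in> Obj0 I \<Longrightarrow> on0 (const_two_functor I A X) i = X"
  "f \<in> Mor1 I \<Longrightarrow> on1 (const_two_functor I A X) f = id1 A X"
  "a \<in> Mor2 I \<Longrightarrow> on2 (const_two_functor I A X) a = id2 A (id1 A X)"
  by (simp_all add: const_two_functor_def)

lemma is_two_functor_const: "X \<in> Obj0 A \<Longrightarrow> is_two_functor I A (const_two_functor I A X)"
  unfolding is_two_functor_def by (auto simp: const_two_functor_def I.horizontal_simps)

lemma is_two_nat_const:
  assumes "f \<in> Mor1 A"
  shows "is_two_nat I A (const_two_nat I A f)"
  using assms
  by (intro is_two_natI) (auto simp: const_two_nat_def is_two_functor_const const_two_functor_simps)

lemma is_modif_const:
  assumes "a \<in> Mor2 A"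
  shows "is_modif I A (const_modif I A a)"
  using assms
  by (intro is_modifI) (auto simp: const_modif_def is_two_nat_const const_two_functor_simps,
      auto simp: const_two_nat_def const_two_functor_simps)

end

section \<open>2-limits and 2-terminal cones\<close>

text \<open>The functor that \<open>two_limit\<close> requires to be an isomorphism for every vertex
  \<open>X\<close>.\<close>

definition comparison_functor where
  "comparison_functor I A X L l =
     comp_functor (post_comp (two_functor_cat I A) (on0 (diag I A) X) l)
                  (hom_functor A (two_functor_cat I A) (diag I A) X L)"

text \<open>A cylinder on \<open>X\<close> is a tensor of \<open>X\<close> with the arrow category, except that the
  2-dimensional part of its universal property is reduced to joint faithfulness of the two ends.\<close>

definition is_cylinder :: "('o, 'm, 't) two_cat \<Rightarrow> 'o \<Rightarrow> 'o \<Rightarrow> 't \<Rightarrow> bool" where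
  "is_cylinder A X T \<theta> \<longleftrightarrow> T \<in> Obj0 A \<and> \<theta> \<in> Arr (hom_cat A X T) \<and>
     (\<forall>Y\<in>Obj0 A. bij_betw (\<lambda>f. hcomp A (id2 A f) \<theta>) (Obj (hom_cat A T Y)) (Arr (hom_cat A X Y))) \<and>
     (\<forall>Y\<in>Obj0 A. \<forall>b\<in>Arr (hom_cat A T Y). \<forall>c\<in>Arr (hom_cat A T Y). dom2 A b = dom2 A c \<longrightarrow> cod2 A b = cod2 A c \<longrightarrow>
        hcomp A b (id2 A (dom2 A \<theta>)) = hcomp A c (id2 A (dom2 A \<theta>)) \<longrightarrow>
        hcomp A b (id2 A (cod2 A \<theta>)) = hcomp A c (id2 A (cod2 A \<theta>)) \<longrightarrow> b = c)"

lemma Obj_hom_cat [simp]: "f \<in> Obj (hom_cat A X Y) \<longleftrightarrow> f \<in> Mor1 A \<and> dom1 A f = X \<and> cod1 A f = Y"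
  and Arr_hom_cat [simp]:
    "a \<in> Arr (hom_cat A X Y) \<longleftrightarrow> a \<in> Mor2 A \<and> dom1 A (dom2 A a) = X \<and> cod1 A (dom2 A a) = Y"
  and hom_cat_ops [simp]: "Dom (hom_cat A X Y) = dom2 A" "Cod (hom_cat A X Y) = cod2 A"
    "Ident (hom_cat A X Y) = id2 A" "Comp (hom_cat A X Y) = vcomp A"
  by (simp_all add: hom_cat_def)

context two_category_pair
begin

lemma two_cone_iff: "two_cone I A F X u \<longleftrightarrow>
  X \<in> Obj0 A \<and> is_two_nat I A u \<and> tdom u = const_two_functor I A X \<and> tcod u = F"
  by (auto simp: two_cone_def FC_def diag_def)

text \<open>Reduces an equation of cones to equations in \<open>A\<close>: the boundaries already
  agree by the typing assumptions, and components are extensional.\<close>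

lemma cone_comp_eq_iff:
  assumes "two_cone I A F L l" "f \<in> Obj (hom_cat A X L)"
    "is_two_nat I A u" "tdom u = const_two_functor I A X" "tcod u = F"
  shows "comp1 FC l (const_two_nat I A f) = u \<longleftrightarrow> (\<forall>i\<in>Obj0 I. comp1 A (tcmp l i) f = tcmp u i)"
proof
  assume "comp1 FC l (const_two_nat I A f) = u"
  then show "\<forall>i\<in>Obj0 I. comp1 A (tcmp l i) f = tcmp u i"
    by (auto simp: FC_def const_two_nat_def)
next
  assume *: "\<forall>i\<in>Obj0 I. comp1 A (tcmp l i) f = tcmp u i"
  have "is_two_nat I A (comp1 FC l (const_two_nat I A f))"
    using assms by (intro is_two_nat_comp1 is_two_nat_const) (auto simp: two_cone_iff const_two_nat_def)
  then show "comp1 FC l (const_two_nat I A f) = u"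
    by (rule two_nat_eqI) (use assms * in \<open>auto simp: two_cone_iff FC_def const_two_nat_def\<close>)
qed

section \<open>The comparison functor\<close>

lemma comparison_functor_simps:
  assumes "two_cone I A F L l" "X \<in> Obj0 A"
  shows "fdom (comparison_functor I A X L l) = hom_cat A X L"
    and "fcod (comparison_functor I A X L l) = hom_cat FC (const_two_functor I A X) F"
    and "f \<in> Obj (hom_cat A X L) \<Longrightarrow>
      fobj (comparison_functor I A X L l) f = comp1 FC l (const_two_nat I A f)"
    and "a \<in> Arr (hom_cat A X L) \<Longrightarrow>
      farr (comparison_functor I A X L l) a = hcomp FC (id2 FC l) (const_modif I A a)"
proof -
  \<comment> \<open>The diagonal lands where post-composition with \<open>l\<close> is defined, so
    the \<open>restrict\<close>s inside \<open>post_comp\<close> evaluate.\<close>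
  have "const_two_nat I A f \<in> Obj (hom_cat FC (const_two_functor I A X) (const_two_functor I A L))"
    if "f \<in> Obj (hom_cat A X L)" for f
    using that by (auto simp: FC_simps is_two_nat_const) (auto simp: const_two_nat_def)
  moreover
  have "const_modif I A a \<in> Arr (hom_cat FC (const_two_functor I A X) (const_two_functor I A L))"
    if "a \<in> Arr (hom_cat A X L)" for a
    using that by (auto simp: FC_simps is_modif_const) (auto simp: const_modif_def const_two_nat_def)
  moreover have "f \<in> Obj (hom_cat A X L) \<Longrightarrow> f \<in> Mor1 A" "a \<in> Arr (hom_cat A X L) \<Longrightarrow> a \<in> Mor2 A" for f a
    by simp_all
  ultimately show "fdom (comparison_functor I A X L l) = hom_cat A X L"
    "fcod (comparison_functor I A X L l) = hom_cat FC (const_two_functor I A X) F"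
    "f \<in> Obj (hom_cat A X L) \<Longrightarrow>
      fobj (comparison_functor I A X L l) f = comp1 FC l (const_two_nat I A f)"
    "a \<in> Arr (hom_cat A X L) \<Longrightarrow>
      farr (comparison_functor I A X L l) a = hcomp FC (id2 FC l) (const_modif I A a)"
    using assms
    by (simp_all add: comparison_functor_def comp_functor_def post_comp_def hom_functor_def diag_def
        two_cone_iff FC_simps del: Obj_hom_cat Arr_hom_cat)
qed

lemma is_modif_cone_whisker:
  assumes "two_cone I A F L l" "a \<in> Arr (hom_cat A X L)"
  shows "is_modif I A (hcomp FC (id2 FC l) (const_modif I A a))"
    and "mdom (hcomp FC (id2 FC l) (const_modif I A a)) = comp1 FC l (const_two_nat I A (dom2 A a))"
    and "mcod (hcomp FC (id2 FC l) (const_modif I A a)) = comp1 FC l (const_two_nat I A (cod2 A a))"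
    and "i \<in> Obj0 I \<Longrightarrow>
      mcmp (hcomp FC (id2 FC l) (const_modif I A a)) i = hcomp A (id2 A (tcmp l i)) a"
proof -
  show "is_modif I A (hcomp FC (id2 FC l) (const_modif I A a))"
    using assms by (intro is_modif_hcomp is_modif_id2 is_modif_const)
      (auto simp: two_cone_iff FC_def const_modif_def const_two_nat_def)
qed (auto simp: FC_def const_modif_def)

lemma is_functor_comparison_functor:
  assumes l: "two_cone I A F L l" and X: "X \<in> Obj0 A"
  shows "is_functor (comparison_functor I A X L l)"
proof -
  have lF: "is_two_nat I A l" "tdom l = const_two_functor I A L" "tcod l = F" "L \<in> Obj0 A"
    using l by (auto simp: two_cone_iff)
  note N = is_two_natD[OF lF(1), unfolded lF]
  note W = is_modif_cone_whisker[OF l]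
  note S = comparison_functor_simps[OF l X]
  have ob: "is_two_nat I A (comp1 FC l (const_two_nat I A f))" if "f \<in> Mor1 A" "cod1 A f = L" for f
    using that lF by (intro is_two_nat_comp1 is_two_nat_const) (auto simp: const_two_nat_def)
  have bd: "tdom (comp1 FC l (const_two_nat I A f)) = const_two_functor I A (dom1 A f)"
    "tcod (comp1 FC l (const_two_nat I A f)) = F" for f
    using lF by (auto simp: FC_def const_two_nat_def)
  show ?thesis
  proof (rule is_functorI, goal_cases)
    case 5
    then show ?case by (simp add: comparison_functor_def comp_functor_def hom_functor_def)
  next
    case 6
    then show ?case by (simp add: comparison_functor_def comp_functor_def hom_functor_def)
  next
    case (9 f)
    then have f: "f \<in> Mor1 A" "dom1 A f = X" "cod1 A f = L" by (simp_all add: S)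
    have "hcomp FC (id2 FC l) (const_modif I A (id2 A f)) = id2 FC (comp1 FC l (const_two_nat I A f))"
    proof (rule modif_eqI)
      show "is_modif I A (hcomp FC (id2 FC l) (const_modif I A (id2 A f)))"
        using f by (intro W(1)[of _ X]) simp
      show "is_modif I A (id2 FC (comp1 FC l (const_two_nat I A f)))"
        using f by (intro is_modif_id2 ob)
    qed (use f in \<open>simp_all add: FC_def N const_two_functor_simps const_two_nat_def const_modif_def\<close>)
    then show ?case using f by (simp add: S)
  next
    case (10 a b)
    then have ab: "a \<in> Mor2 A" "b \<in> Mor2 A" "dom2 A b = cod2 A a" "dom1 A (dom2 A a) = X"
      "cod1 A (dom2 A a) = L" by (simp_all add: S)
    let ?K = "\<lambda>a. hcomp FC (id2 FC l) (const_modif I A a)"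
    have 1: "is_modif I A (?K a)" "is_modif I A (?K b)" "is_modif I A (?K (vcomp A b a))"
      using ab by (auto intro!: W(1)[of _ X])
    \<comment> \<open>Interchange with the identity of \<open>tcmp l i\<close> used twice on the
      left, where it is its own vertical composite.\<close>
    have "hcomp A (id2 A (tcmp l i)) (vcomp A b a) =
      vcomp A (hcomp A (id2 A (tcmp l i)) b) (hcomp A (id2 A (tcmp l i)) a)" if "i \<in> Obj0 I" for i
      using A.interchange[of a b "id2 A (tcmp l i)" "id2 A (tcmp l i)"] ab that by (simp add: N const_two_functor_simps)
    then have "?K (vcomp A b a) = vcomp FC (?K b) (?K a)"
      using ab by (intro modif_eqI[OF 1(3) is_modif_vcomp[OF 1(1,2)]])
        (auto simp: FC_def const_modif_def)
    then show ?case using ab by (simp add: S)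
  qed (auto simp: S A.category_hom_cat category_hom_cat_FC FC_simps ob bd W)
qed

section \<open>Hom-categories of the strict slice\<close>

lemma Obj0_strict_slice: "Obj0 (strict_slice I A F) = {(X, u). two_cone I A F X u}"
  by (simp add: strict_slice_def)

text \<open>Cells of the slice are tagged with source and target cones. Here, and in the analogue
  for 2-morphisms, the tags are separated from the condition on the underlying cell of
  \<open>A\<close>.\<close>

lemma Obj_hom_cat_strict_slice:
  assumes "two_cone I A F X u" "two_cone I A F L l"
  shows "Obj (hom_cat (strict_slice I A F) (X, u) (L, l)) =
    (\<lambda>f. ((X, u), (L, l), f)) ` {f \<in> Obj (hom_cat A X L). comp1 FC l (const_two_nat I A f) = u}"
proof (rule set_eqI)
  fix p :: "('o \<times> ('i, 'j, 'k, 'o, 'm, 't) two_nat) \<times> ('o \<times> ('i, 'j, 'k, 'o, 'm, 't) two_nat) \<times> 'm"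
  obtain X' u' Y' v' f where p: "p = ((X', u'), (Y', v'), f)" by (metis surj_pair)
  show "p \<in> Obj (hom_cat (strict_slice I A F) (X, u) (L, l)) \<longleftrightarrow> p \<in>
    (\<lambda>f. ((X, u), (L, l), f)) ` {f \<in> Obj (hom_cat A X L). comp1 FC l (const_two_nat I A f) = u}"
    unfolding p Obj_hom_cat using assms by (simp add: strict_slice_def diag_def image_iff cong: conj_cong) blast
qed

lemma Arr_hom_cat_strict_slice:
  assumes "two_cone I A F X u" "two_cone I A F L l"
  shows "Arr (hom_cat (strict_slice I A F) (X, u) (L, l)) =
    (\<lambda>a. ((X, u), (L, l), a)) ` {a \<in> Arr (hom_cat A X L).
       comp1 FC l (const_two_nat I A (dom2 A a)) = u \<and> comp1 FC l (const_two_nat I A (cod2 A a)) = u \<and>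
       hcomp FC (id2 FC l) (const_modif I A a) = id2 FC u}"
  (is "?L = ?R")
proof (rule set_eqI)
  fix p :: "('o \<times> ('i, 'j, 'k, 'o, 'm, 't) two_nat) \<times> ('o \<times> ('i, 'j, 'k, 'o, 'm, 't) two_nat) \<times> 't"
  obtain X' u' Y' v' a where p: "p = ((X', u'), (Y', v'), a)" by (metis surj_pair)
  show "p \<in> ?L \<longleftrightarrow> p \<in> ?R"
    unfolding p Arr_hom_cat using assms by (simp add: strict_slice_def diag_def image_iff cong: conj_cong) blast
qed

lemmas strict_slice_simps = Obj0_strict_slice Obj_hom_cat_strict_slice Arr_hom_cat_strict_slice

text \<open>Functoriality of the comparison holds for every cone, so being an isomorphism amounts to
  the two bijections.\<close>

lemma two_limit_iff: "two_limit I A F (L, l) \<longleftrightarrow> two_cone I A F L l \<and>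
  (\<forall>X\<in>Obj0 A. bij_betw (fobj (comparison_functor I A X L l)) (Obj (hom_cat A X L))
                (Obj (hom_cat FC (const_two_functor I A X) F)) \<and>
              bij_betw (farr (comparison_functor I A X L l)) (Arr (hom_cat A X L))
                (Arr (hom_cat FC (const_two_functor I A X) F)))"
  unfolding two_limit_def comparison_functor_def[symmetric] is_iso_functor_iff_bij_betw
  by (auto simp: is_functor_comparison_functor comparison_functor_simps)

text \<open>Bijectivity on objects gives the unique mediating morphism \<open>f\<close>. The
  comparison functor sends the identity of \<open>f\<close> to the identity of \<open>u\<close>, so
  by injectivity on arrows any 2-morphism that whiskers to the identity of \<open>u\<close> is the
  identity of \<open>f\<close>.\<close>

lemma two_terminal_if_two_limit:
  assumes "two_limit I A F (L, l)"
  shows "two_terminal (strict_slice I A F) (L, l)"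
proof -
  from assms have l: "two_cone I A F L l" by (simp add: two_limit_iff)
  have "isomorphic_cats (hom_cat (strict_slice I A F) (X, u) (L, l)) terminal_cat"
    if u: "two_cone I A F X u" for X u
  proof -
    let ?K = "comparison_functor I A X L l" and ?H = "hom_cat (strict_slice I A F) (X, u) (L, l)"
    have X: "X \<in> Obj0 A" using u by (simp add: two_cone_iff)
    note S = comparison_functor_simps[OF l X]
    note K = is_functor_comparison_functor[OF l X]
    have o: "bij_betw (fobj ?K) (Obj (hom_cat A X L)) (Obj (hom_cat FC (const_two_functor I A X) F))"
      and a: "inj_on (farr ?K) (Arr (hom_cat A X L))"
      using assms X by (auto simp: two_limit_iff bij_betw_def)
    have "u \<in> Obj (hom_cat FC (const_two_functor I A X) F)"
      using u by (simp add: two_cone_iff FC_simps)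
    then obtain f where f: "f \<in> Obj (hom_cat A X L)" "fobj ?K f = u"
      unfolding bij_betw_imp_surj_on[OF o, symmetric] by (metis (no_types, lifting) imageE)
    have uniq: "g = f" if "g \<in> Mor1 A" "dom1 A g = X" "cod1 A g = L" "fobj ?K g = u" for g
      using inj_onD[OF bij_betw_imp_inj_on[OF o], of g f] f that by simp
    have O: "Obj ?H = {((X, u), (L, l), f)}"
      using u l f uniq by (auto simp: strict_slice_simps S)
    have Kid: "farr ?K (id2 A f) = id2 FC u"
      using is_functorD(9)[OF K, of f] f by (simp add: S)
    have "a = id2 A f" if "a \<in> Arr (hom_cat A X L)" "comp1 FC l (const_two_nat I A (dom2 A a)) = u"
      "hcomp FC (id2 FC l) (const_modif I A a) = id2 FC u" for a
      using that Kid f(1) by (intro inj_onD[OF a]) (auto simp: S)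
    then have Ar: "Arr ?H = {((X, u), (L, l), id2 A f)}"
      using u l f Kid by (auto simp: strict_slice_simps S)
    \<comment> \<open>With one object and one arrow, an identity, the category axioms are evaluated
      directly.\<close>
    have "category ?H"
      unfolding category_def O Ar using f(1) by (simp add: strict_slice_def)
    then show ?thesis
      by (simp add: isomorphic_terminal_cat_iff O Ar)
  qed
  then show ?thesis
    using l by (auto simp: two_terminal_def strict_slice_simps)
qed

text \<open>The one-dimensional universal property. The converse applies it to cones with vertex
  \<open>X\<close> and to cones whose vertex is a cylinder on \<open>X\<close>.\<close>

lemma ex1_cone_morphism_if_two_terminal:
  assumes "two_terminal (strict_slice I A F) (L, l)" "two_cone I A F X u"
  shows "\<exists>!f. f \<in> Obj (hom_cat A X L) \<and> comp1 FC l (const_two_nat I A f) = u"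
proof -
  have l: "two_cone I A F L l" using assms by (simp add: two_terminal_def strict_slice_simps)
  have "(X, u) \<in> Obj0 (strict_slice I A F)" using assms by (simp add: Obj0_strict_slice)
  then obtain p where p: "Obj (hom_cat (strict_slice I A F) (X, u) (L, l)) = {p}"
    using assms(1) unfolding two_terminal_def isomorphic_terminal_cat_iff by blast
  let ?S = "{f \<in> Obj (hom_cat A X L). comp1 FC l (const_two_nat I A f) = u}"
  have S: "(\<lambda>f. ((X, u), (L, l), f)) ` ?S = {p}"
    using p Obj_hom_cat_strict_slice[OF assms(2) l] by simp
  then obtain f where f: "f \<in> ?S" "p = ((X, u), (L, l), f)" by (blast dest: equalityD2)
  have "g = f" if "g \<in> ?S" for g
    using imageI[OF that, of "\<lambda>f. ((X, u), (L, l), f)"] unfolding S f(2) by simp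
  with f(1) show ?thesis by blast
qed

text \<open>The components of \<open>w\<close> are the transposes of those of \<open>p\<close>. Its compatibility with the
  2-morphisms of \<open>I\<close> compares 2-morphisms out of \<open>T\<close>, which can be tested on the two ends.\<close>

lemma cone_of_modif:
  assumes p: "is_modif I A p" "tdom (mdom p) = const_two_functor I A X" "tcod (mdom p) = F"
    and T: "is_cylinder A X T \<theta>"
  obtains w where "two_cone I A F T w"
    and "\<And>i. i \<in> Obj0 I \<Longrightarrow> hcomp A (id2 A (tcmp w i)) \<theta> = mcmp p i"
proof -
  note P = is_modifD[OF p(1), unfolded p(2-3)]
  note U = is_two_natD[OF P(1), unfolded p(2-3)] and V = is_two_natD[OF P(2), unfolded P(3-4)]
  note F = is_two_functorD[OF U(2)]
  have th: "T \<in> Obj0 A" "\<theta> \<in> Mor2 A" "dom1 A (dom2 A \<theta>) = X" "cod1 A (dom2 A \<theta>) = T"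
    using T by (auto simp: is_cylinder_def)
  have bij: "bij_betw (\<lambda>f. hcomp A (id2 A f) \<theta>) (Obj (hom_cat A T Y)) (Arr (hom_cat A X Y))"
    if "Y \<in> Obj0 A" for Y
    using T that by (simp add: is_cylinder_def)
  have inj: "f = g" if "f \<in> Mor1 A" "g \<in> Mor1 A" "dom1 A f = T" "dom1 A g = T" "cod1 A f = cod1 A g"
    "hcomp A (id2 A f) \<theta> = hcomp A (id2 A g) \<theta>" for f g
    using bij[of "cod1 A g"] that by (auto simp: bij_betw_def dest!: inj_onD)
  have "\<exists>f. f \<in> Obj (hom_cat A T (on0 F i)) \<and> hcomp A (id2 A f) \<theta> = mcmp p i" if "i \<in> Obj0 I" for i
  proof -
    have "mcmp p i \<in> Arr (hom_cat A X (on0 F i))"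
      using that by (simp add: P U const_two_functor_simps)
    then show ?thesis
      using bij[of "on0 F i"] F(1)[OF that] unfolding bij_betw_def by (metis (no_types, lifting) imageE)
  qed
  then obtain w where w: "\<And>i. i \<in> Obj0 I \<Longrightarrow> w i \<in> Obj (hom_cat A T (on0 F i))"
    and wp: "\<And>i. i \<in> Obj0 I \<Longrightarrow> hcomp A (id2 A (w i)) \<theta> = mcmp p i" by metis
  have w [simp]: "w i \<in> Mor1 A" "dom1 A (w i) = T" "cod1 A (w i) = on0 F i" if "i \<in> Obj0 I" for i
    using w[OF that] by auto
  \<comment> \<open>Boundaries of the equation that defines \<open>w i\<close>: on the two ends of
    the cylinder, \<open>w\<close> restricts to the cones \<open>mdom p\<close> and
    \<open>mcod p\<close>.\<close>
  have wd: "comp1 A (w i) (dom2 A \<theta>) = tcmp (mdom p) i" "comp1 A (w i) (cod2 A \<theta>) = tcmp (mcod p) i"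
    if "i \<in> Obj0 I" for i
    using arg_cong[OF wp[OF that], of "dom2 A"] arg_cong[OF wp[OF that], of "cod2 A"] that
    by (simp_all add: th P)
  \<comment> \<open>Transposition along \<open>\<theta>\<close> is injective, and the transposed
    equation is the modification axiom of \<open>p\<close> at \<open>f\<close>; the source of the
    cones is constant, so one whiskering there is by an identity.\<close>
  have nat: "comp1 A (on1 F f) (w (dom1 I f)) = w (cod1 I f)" if f: "f \<in> Mor1 I" for f
  proof (rule inj)
    have "hcomp A (id2 A (comp1 A (on1 F f) (w (dom1 I f)))) \<theta> =
      hcomp A (id2 A (on1 F f)) (mcmp p (dom1 I f))"
      using f by (subst A.whisker_assoc[symmetric]) (simp_all add: th F wp)
    also have "\<dots> = mcmp p (cod1 I f)"
      using P(9)[OF f] f by (simp add: const_two_functor_simps P U)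
    finally show "hcomp A (id2 A (comp1 A (on1 F f) (w (dom1 I f)))) \<theta> =
      hcomp A (id2 A (w (cod1 I f))) \<theta>" using f by (simp add: wp)
  qed (use f F in auto)
  have nat2: "hcomp A (on2 F a) (id2 A (w (dom1 I (dom2 I a)))) = id2 A (w (cod1 I (dom2 I a)))"
    (is "?b = ?c") if a: "a \<in> Mor2 I" for a
  proof -
    let ?s = "dom1 I (dom2 I a)" and ?t = "cod1 I (dom2 I a)"
    have b: "?b \<in> Arr (hom_cat A T (on0 F ?t))" "?c \<in> Arr (hom_cat A T (on0 F ?t))"
      using a by (simp_all add: F)
    \<comment> \<open>The two sides are parallel by naturality of \<open>w\<close> at both the
      source and the target of \<open>a\<close>.\<close>
    have d: "dom2 A ?b = dom2 A ?c" "cod2 A ?b = cod2 A ?c"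
      using a nat[of "dom2 I a"] nat[of "cod2 I a"] by (simp_all add: F)
    \<comment> \<open>At the source end the equation is 2-naturality of \<open>mdom p\<close>;
      below, at the target end, it is that of \<open>mcod p\<close>.\<close>
    have "hcomp A ?b (id2 A (dom2 A \<theta>)) = hcomp A (on2 F a) (id2 A (tcmp (mdom p) ?s))"
      using a by (simp add: A.hcomp_assoc F th wd)
    also have "\<dots> = hcomp A ?c (id2 A (dom2 A \<theta>))"
      using a U(8)[OF a] by (simp add: th wd const_two_functor_simps U(3-6))
    finally have e0: "hcomp A ?b (id2 A (dom2 A \<theta>)) = hcomp A ?c (id2 A (dom2 A \<theta>))" .
    have "hcomp A ?b (id2 A (cod2 A \<theta>)) = hcomp A (on2 F a) (id2 A (tcmp (mcod p) ?s))"
      using a by (simp add: A.hcomp_assoc F th wd)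
    also have "\<dots> = hcomp A ?c (id2 A (cod2 A \<theta>))"
      using a V(8)[OF a] by (simp add: th wd const_two_functor_simps V(3-6))
    finally have e1: "hcomp A ?b (id2 A (cod2 A \<theta>)) = hcomp A ?c (id2 A (cod2 A \<theta>))" .
    have "on0 F ?t \<in> Obj0 A" using a by (simp add: F)
    with b d e0 e1 T show ?thesis unfolding is_cylinder_def by blast
  qed
  \<comment> \<open>The family \<open>w\<close> comes from a choice and is arbitrary off the objects
    of \<open>I\<close>; \<open>restrict\<close> makes it extensional.\<close>
  define W where "W = \<lparr>tdom = const_two_functor I A T, tcod = F, tcmp = restrict w (Obj0 I)\<rparr>"
  have "is_two_nat I A W"
    by (rule is_two_natI) (use th U in \<open>auto simp: W_def is_two_functor_const const_two_functor_simps nat nat2\<close>)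
  then have "two_cone I A F T W"
    by (simp add: two_cone_iff W_def th)
  then show thesis
    by (rule that) (simp add: W_def wp)
qed

text \<open>Transposition along \<open>\<theta>\<close> lowers the dimension: injectivity on
  2-morphisms becomes uniqueness, and surjectivity becomes existence, of a mediating morphism out of
  the cylinder \<open>T\<close>.\<close>

lemma two_limit_if_two_terminal:
  assumes t: "two_terminal (strict_slice I A F) (L, l)"
    and cyl: "\<And>X. X \<in> Obj0 A \<Longrightarrow> \<exists>T \<theta>. is_cylinder A X T \<theta>"
  shows "two_limit I A F (L, l)"
proof -
  have l: "two_cone I A F L l" using t by (simp add: two_terminal_def strict_slice_simps)
  then have l': "is_two_nat I A l" "tdom l = const_two_functor I A L" "tcod l = F" "L \<in> Obj0 A"
    by (auto simp: two_cone_iff)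
  note N = is_two_natD[OF l'(1), unfolded l']
  show ?thesis unfolding two_limit_iff
  proof (intro conjI ballI l)
    fix X assume X: "X \<in> Obj0 A"
    let ?K = "comparison_functor I A X L l"
    let ?D = "hom_cat FC (const_two_functor I A X) F"
    note S = comparison_functor_simps[OF l X]
    note K = is_functorD[OF is_functor_comparison_functor[OF l X], unfolded S(1,2)]
    have ex1: "\<exists>!f. f \<in> Obj (hom_cat A X L) \<and> fobj ?K f = u" if "u \<in> Obj ?D" for u
    proof -
      have "two_cone I A F X u" using that X by (simp add: two_cone_iff FC_simps)
      then show ?thesis
        using ex1_cone_morphism_if_two_terminal[OF t] S(3) by (metis (no_types, lifting))
    qed
    show "bij_betw (fobj ?K) (Obj (hom_cat A X L)) (Obj ?D)"
    proof (rule bij_betwI', goal_cases)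
      case (1 f g)
      then show ?case using ex1[OF K(3)[OF 1(1)]] by (metis (no_types, lifting))
    next
      case (2 f)
      then show ?case by (rule K(3))
    next
      case (3 u)
      then show ?case using ex1[OF 3] by (metis (no_types, lifting))
    qed
    obtain T \<theta> where T: "is_cylinder A X T \<theta>" using cyl[OF X] by blast
    then have th: "T \<in> Obj0 A" "\<theta> \<in> Mor2 A" "dom1 A (dom2 A \<theta>) = X" "cod1 A (dom2 A \<theta>) = T"
      by (auto simp: is_cylinder_def)
    have bij: "bij_betw (\<lambda>f. hcomp A (id2 A f) \<theta>) (Obj (hom_cat A T Y)) (Arr (hom_cat A X Y))"
      if "Y \<in> Obj0 A" for Y
      using T that by (simp add: is_cylinder_def)
    have whisk: "hcomp A (id2 A (tcmp l i)) (hcomp A (id2 A g) \<theta>) =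
        hcomp A (id2 A (comp1 A (tcmp l i) g)) \<theta>"
      if "i \<in> Obj0 I" "g \<in> Obj (hom_cat A T L)" for i g
      using that by (intro A.whisker_assoc) (simp_all add: th N const_two_functor_simps)
    show "bij_betw (farr ?K) (Arr (hom_cat A X L)) (Arr ?D)"
      unfolding bij_betw_def
    proof
      show "inj_on (farr ?K) (Arr (hom_cat A X L))"
      proof
        fix a b assume a: "a \<in> Arr (hom_cat A X L)" and b: "b \<in> Arr (hom_cat A X L)"
          and "farr ?K a = farr ?K b"
        then have eq: "hcomp A (id2 A (tcmp l i)) a = hcomp A (id2 A (tcmp l i)) b" if "i \<in> Obj0 I" for i
          using that is_modif_cone_whisker(4)[OF l a] is_modif_cone_whisker(4)[OF l b] S(4)[OF a] S(4)[OF b]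
          by metis
        obtain g h where g: "g \<in> Obj (hom_cat A T L)" "a = hcomp A (id2 A g) \<theta>"
          and h: "h \<in> Obj (hom_cat A T L)" "b = hcomp A (id2 A h) \<theta>"
          using bij[OF l'(4)] a b unfolding bij_betw_def by (metis (no_types, lifting) imageE)
        \<comment> \<open>The equal whiskerings of \<open>a\<close> and \<open>b\<close> are the
          transposes of these two composites, and transposition is injective for the target
          \<open>on0 F i\<close> as well.\<close>
        have lgh: "comp1 A (tcmp l i) g = comp1 A (tcmp l i) h" if i: "i \<in> Obj0 I" for i
        proof -
          have "on0 F i \<in> Obj0 A" using is_two_functorD(1)[OF N(2) i] .
          from bij[OF this] have "inj_on (\<lambda>f. hcomp A (id2 A f) \<theta>) (Obj (hom_cat A T (on0 F i)))"
            by (simp add: bij_betw_def)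
          moreover have "hcomp A (id2 A (comp1 A (tcmp l i) g)) \<theta> = hcomp A (id2 A (comp1 A (tcmp l i) h)) \<theta>"
            using whisk[OF i g(1)] whisk[OF i h(1)] eq[OF i] g h by simp
          ultimately show ?thesis
            by (rule inj_onD) (use g h i in \<open>simp_all add: N const_two_functor_simps\<close>)
        qed
        \<comment> \<open>A cone with vertex \<open>T\<close> that both \<open>g\<close> and
          \<open>h\<close> mediate.\<close>
        let ?u = "comp1 FC l (const_two_nat I A g)"
        have u: "is_two_nat I A ?u" "tdom ?u = const_two_functor I A T" "tcod ?u = F"
          using is_functorD(3)[OF is_functor_comparison_functor[OF l th(1)], of g] g(1)
          unfolding comparison_functor_simps[OF l th(1)]
          by (simp_all add: comparison_functor_simps[OF l th(1)] FC_simps)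
        then have "two_cone I A F T ?u" using th by (simp add: two_cone_iff)
        moreover have "comp1 FC l (const_two_nat I A h) = ?u"
          by (subst cone_comp_eq_iff[OF l h(1) u]) (simp add: lgh FC_def const_two_nat_def)
        ultimately have "g = h"
          using ex1_cone_morphism_if_two_terminal[OF t, of T ?u] g h by blast
        then show "a = b" using g h by simp
      qed
      show "farr ?K ` Arr (hom_cat A X L) = Arr ?D"
      proof
        show "farr ?K ` Arr (hom_cat A X L) \<subseteq> Arr ?D" using K(4) by blast
        show "Arr ?D \<subseteq> farr ?K ` Arr (hom_cat A X L)"
        proof
          fix p assume "p \<in> Arr ?D"
          then have p: "is_modif I A p" "tdom (mdom p) = const_two_functor I A X" "tcod (mdom p) = F"
            by (simp_all add: FC_simps)
          note P = is_modifD[OF p(1)]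
          obtain w where w: "two_cone I A F T w"
            and wp: "\<And>i. i \<in> Obj0 I \<Longrightarrow> hcomp A (id2 A (tcmp w i)) \<theta> = mcmp p i"
            using cone_of_modif[OF p T] by blast
          obtain g where g: "g \<in> Obj (hom_cat A T L)" "comp1 FC l (const_two_nat I A g) = w"
            using ex1_cone_morphism_if_two_terminal[OF t w] by blast
          then have lg: "tcmp w i = comp1 A (tcmp l i) g" if "i \<in> Obj0 I" for i
            using that by (auto simp: FC_def const_two_nat_def)
          \<comment> \<open>Transposing \<open>g\<close> back: whiskering \<open>a\<close> with
            \<open>tcmp l i\<close> gives the transpose of \<open>tcmp w i\<close>, which is
            \<open>mcmp p i\<close>.\<close>
          define a where "a = hcomp A (id2 A g) \<theta>"
          have a: "a \<in> Arr (hom_cat A X L)" using g th by (simp add: a_def)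
          have la: "hcomp A (id2 A (tcmp l i)) a = mcmp p i" if "i \<in> Obj0 I" for i
            using that wp[OF that] whisk[OF that g(1)] by (simp add: a_def lg)
          let ?q = "hcomp FC (id2 FC l) (const_modif I A a)"
          note Q = is_modif_cone_whisker[OF l a]
          have "comp1 FC l (const_two_nat I A (dom2 A a)) = mdom p"
            using a p P la[THEN arg_cong, of _ "dom2 A"]
            by (subst cone_comp_eq_iff[OF l, of _ X]) (auto simp: N const_two_functor_simps)
          moreover have "comp1 FC l (const_two_nat I A (cod2 A a)) = mcod p"
            using a p P la[THEN arg_cong, of _ "cod2 A"]
            by (subst cone_comp_eq_iff[OF l, of _ X]) (auto simp: N const_two_functor_simps)
          ultimately have "?q = p"
            using Q p(1) la by (intro modif_eqI[OF Q(1) p(1)]) simp_all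
          then show "p \<in> farr ?K ` Arr (hom_cat A X L)"
            using a S(4)[OF a] by (metis imageI)
        qed
      qed
    qed
  qed
qed

end

section \<open>The 2-category of small categories\<close>

lemma is_ntransD:
  assumes "is_ntrans t"
  shows "is_functor (ndom t)" "is_functor (ncod t)"
      "fdom (ncod t) = fdom (ndom t)" "fcod (ncod t) = fcod (ndom t)"
    and "ncmp t \<in> extensional (Obj (fdom (ndom t)))"
    and "x \<in> Obj (fdom (ndom t)) \<Longrightarrow> ncmp t x \<in> Arr (fcod (ndom t))"
      "x \<in> Obj (fdom (ndom t)) \<Longrightarrow> Dom (fcod (ndom t)) (ncmp t x) = fobj (ndom t) x"
      "x \<in> Obj (fdom (ndom t)) \<Longrightarrow> Cod (fcod (ndom t)) (ncmp t x) = fobj (ncod t) x"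
    and "f \<in> Arr (fdom (ndom t)) \<Longrightarrow>
      Comp (fcod (ndom t)) (ncmp t (Cod (fdom (ndom t)) f)) (farr (ndom t) f) =
      Comp (fcod (ndom t)) (farr (ncod t) f) (ncmp t (Dom (fdom (ndom t)) f))"
  using assms unfolding is_ntrans_def Let_def by (auto simp: PiE_def Pi_def)

lemma is_ntransI:
  assumes "is_functor (ndom t)" "is_functor (ncod t)"
      "fdom (ncod t) = fdom (ndom t)" "fcod (ncod t) = fcod (ndom t)"
    and "ncmp t \<in> extensional (Obj (fdom (ndom t)))"
    and "\<And>x. x \<in> Obj (fdom (ndom t)) \<Longrightarrow> ncmp t x \<in> Arr (fcod (ndom t))"
      "\<And>x. x \<in> Obj (fdom (ndom t)) \<Longrightarrow> Dom (fcod (ndom t)) (ncmp t x) = fobj (ndom t) x"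
      "\<And>x. x \<in> Obj (fdom (ndom t)) \<Longrightarrow> Cod (fcod (ndom t)) (ncmp t x) = fobj (ncod t) x"
    and "\<And>f. f \<in> Arr (fdom (ndom t)) \<Longrightarrow>
      Comp (fcod (ndom t)) (ncmp t (Cod (fdom (ndom t)) f)) (farr (ndom t) f) =
      Comp (fcod (ndom t)) (farr (ncod t) f) (ncmp t (Dom (fdom (ndom t)) f))"
  shows "is_ntrans t"
  using assms unfolding is_ntrans_def Let_def by (auto simp: PiE_def)

lemma ntrans_eqI:
  fixes s t :: "('o, 'a, 'p, 'b) ntrans"
  assumes "is_ntrans s" "is_ntrans t" "ndom s = ndom t" "ncod s = ncod t"
    and "\<And>x. x \<in> Obj (fdom (ndom t)) \<Longrightarrow> ncmp s x = ncmp t x"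
  shows "s = t"
proof -
  have "ncmp s = ncmp t"
    by (rule extensionalityI[of _ "Obj (fdom (ndom t))"])
      (use assms is_ntransD(5)[OF assms(1)] is_ntransD(5)[OF assms(2)] in auto)
  then show ?thesis using assms by simp
qed

section \<open>The 2-category laws for functors and natural transformations\<close>

lemma functor_boundary_simps [simp]:
  "fdom (id_functor C) = C" "fcod (id_functor C) = C"
  "fdom (comp_functor G F) = fdom F" "fcod (comp_functor G F) = fcod G"
  by (simp_all add: id_functor_def comp_functor_def)

lemma ntrans_boundary_simps [simp]:
  "ndom (id_ntrans F) = F" "ncod (id_ntrans F) = F"
  "ndom (vcomp_ntrans t s) = ndom s" "ncod (vcomp_ntrans t s) = ncod t"
  "ndom (hcomp_ntrans b a) = comp_functor (ndom b) (ndom a)"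
  "ncod (hcomp_ntrans b a) = comp_functor (ncod b) (ncod a)"
  by (simp_all add: id_ntrans_def vcomp_ntrans_def hcomp_ntrans_def)

lemma is_functor_id: "category C \<Longrightarrow> is_functor (id_functor C)"
  by (rule is_functorI) (auto simp: id_functor_def categoryD)

lemma is_functor_comp:
  assumes F: "is_functor F" and G: "is_functor G" and FG: "fdom G = fcod F"
  shows "is_functor (comp_functor G F)"
proof -
  note D = is_functorD[OF F] is_functorD[OF G, unfolded FG]
  show ?thesis
    by (rule is_functorI) (simp_all add: comp_functor_def D categoryD[OF D(1)] del: restrict_extensional,
        simp_all)
qed

lemma comp_functor_id:
  assumes "is_functor F"
  shows "comp_functor F (id_functor (fdom F)) = F" "comp_functor (id_functor (fcod F)) F = F"
proof -
  note F = is_functorD[OF assms]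
  have *: "is_functor (comp_functor F (id_functor (fdom F)))" "is_functor (comp_functor (id_functor (fcod F)) F)"
    using assms F by (auto intro!: is_functor_comp is_functor_id)
  show "comp_functor F (id_functor (fdom F)) = F"
    by (rule func_eqI[OF *(1) assms]) (auto simp: comp_functor_def id_functor_def)
  show "comp_functor (id_functor (fcod F)) F = F"
    by (rule func_eqI[OF *(2) assms]) (auto simp: comp_functor_def id_functor_def F)
qed

lemma comp_functor_assoc:
  assumes "is_functor F" "is_functor G" "fdom G = fcod F"
  shows "comp_functor H (comp_functor G F) = comp_functor (comp_functor H G) F"
  using is_functorD(3,4)[OF assms(1)] assms(3) by (auto simp: comp_functor_def fun_eq_iff restrict_def)

lemma is_ntrans_id: "is_functor F \<Longrightarrow> is_ntrans (id_ntrans F)"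
  by (rule is_ntransI) (auto simp: id_ntrans_def is_functorD categoryD[OF is_functorD(1)]
      categoryD[OF is_functorD(2)])

lemma is_ntrans_vcomp:
  assumes s: "is_ntrans s" and t: "is_ntrans t" and st: "ndom t = ncod s"
  shows "is_ntrans (vcomp_ntrans t s)"
proof -
  note S = is_ntransD[OF s] and T = is_ntransD[OF t, unfolded st]
  note F = is_functorD[OF S(1)] and G = is_functorD[OF S(2), unfolded S(3,4)]
    and H = is_functorD[OF T(2), unfolded T(3,4) S(3,4)]
  note C = categoryD[OF F(1)] and D = categoryD[OF F(2)]
  let ?D = "fcod (ndom s)"
  note simps = S(1-8) T(1-8)[unfolded S(3,4)] F G H C D(1-10)
  show ?thesis
  proof (rule is_ntransI, goal_cases)
    case (9 f)
    then have f: "f \<in> Arr (fdom (ndom s))" by (simp add: vcomp_ntrans_def)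
    let ?x = "Dom (fdom (ndom s)) f" and ?y = "Cod (fdom (ndom s)) f"
    have "Comp ?D (Comp ?D (ncmp t ?y) (ncmp s ?y)) (farr (ndom s) f) =
      Comp ?D (ncmp t ?y) (Comp ?D (farr (ncod s) f) (ncmp s ?x))"
      using f by (simp add: simps D(11) S(9))
    also have "\<dots> = Comp ?D (Comp ?D (ncmp t ?y) (farr (ncod s) f)) (ncmp s ?x)"
      using f by (simp add: simps D(11))
    also have "\<dots> = Comp ?D (farr (ncod t) f) (Comp ?D (ncmp t ?x) (ncmp s ?x))"
      using f by (simp add: simps D(11) T(9)[unfolded S(3,4)])
    finally show ?case using f by (simp add: vcomp_ntrans_def C)
  qed (use simps in \<open>auto simp: vcomp_ntrans_def\<close>)
qed

lemma vcomp_ntrans_id: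
  assumes "is_ntrans t"
  shows "vcomp_ntrans t (id_ntrans (ndom t)) = t" "vcomp_ntrans (id_ntrans (ncod t)) t = t"
proof -
  note T = is_ntransD[OF assms]
  note D = categoryD[OF is_functorD(2)[OF T(1)]]
  have *: "is_ntrans (vcomp_ntrans t (id_ntrans (ndom t)))" "is_ntrans (vcomp_ntrans (id_ntrans (ncod t)) t)"
    using assms T by (auto intro!: is_ntrans_vcomp is_ntrans_id)
  show "vcomp_ntrans t (id_ntrans (ndom t)) = t"
    by (rule ntrans_eqI[OF *(1) assms]) (auto simp: vcomp_ntrans_def id_ntrans_def T D)
  show "vcomp_ntrans (id_ntrans (ncod t)) t = t"
    by (rule ntrans_eqI[OF *(2) assms]) (auto simp: vcomp_ntrans_def id_ntrans_def T D)
qed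

lemma vcomp_ntrans_assoc:
  assumes "is_ntrans r" "is_ntrans s" "is_ntrans t" "ndom s = ncod r" "ndom t = ncod s"
  shows "vcomp_ntrans t (vcomp_ntrans s r) = vcomp_ntrans (vcomp_ntrans t s) r"
proof -
  note R = is_ntransD[OF assms(1)] and S = is_ntransD[OF assms(2)] and T = is_ntransD[OF assms(3)]
  note D = categoryD[OF is_functorD(2)[OF R(1)]]
  show ?thesis
    using assms(4,5) R S T by (auto simp: vcomp_ntrans_def D(11) fun_eq_iff restrict_def)
qed

text \<open>The square at \<open>f\<close> pastes two squares: that of \<open>s\<close> at
  \<open>f\<close>, mapped by \<open>ndom t\<close>, and that of \<open>t\<close> at the arrow
  \<open>farr (ncod s) f\<close>.\<close>

lemma is_ntrans_hcomp:
  assumes s: "is_ntrans s" and t: "is_ntrans t" and st: "fdom (ndom t) = fcod (ndom s)"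
  shows "is_ntrans (hcomp_ntrans t s)"
proof -
  note S = is_ntransD[OF s] and T = is_ntransD[OF t, unfolded st]
  note F = is_functorD[OF S(1)] and G = is_functorD[OF S(2), unfolded S(3,4)]
    and H = is_functorD[OF T(1), unfolded st] and K = is_functorD[OF T(2), unfolded T(3,4)]
  note C = categoryD[OF F(1)] and D = categoryD[OF F(2)] and E = categoryD[OF H(2)]
  let ?C = "fdom (ndom s)" and ?D = "fcod (ndom s)" and ?E = "fcod (ndom t)"
  note simps = S(1-8) T(1-8) F G H K C D(1-10) E(1-10)
  have 12: "is_functor (comp_functor (ndom t) (ndom s))" "is_functor (comp_functor (ncod t) (ncod s))"
    using S T st by (auto intro: is_functor_comp)
  show ?thesis
  proof (rule is_ntransI, goal_cases)
    case (9 f)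
    then have f: "f \<in> Arr ?C" by (simp add: hcomp_ntrans_def comp_functor_def)
    let ?x = "Dom ?C f" and ?y = "Cod ?C f"
    have "Comp ?E (Comp ?E (ncmp t (fobj (ncod s) ?y)) (farr (ndom t) (ncmp s ?y)))
        (farr (ndom t) (farr (ndom s) f)) =
      Comp ?E (ncmp t (fobj (ncod s) ?y)) (farr (ndom t) (Comp ?D (ncmp s ?y) (farr (ndom s) f)))"
      using f by (simp add: simps E(11))
    also have "\<dots> = Comp ?E (ncmp t (fobj (ncod s) ?y)) (farr (ndom t) (Comp ?D (farr (ncod s) f) (ncmp s ?x)))"
      using f by (simp add: S(9))
    also have "\<dots> = Comp ?E (Comp ?E (ncmp t (fobj (ncod s) ?y)) (farr (ndom t) (farr (ncod s) f)))
        (farr (ndom t) (ncmp s ?x))"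
      using f by (simp add: simps E(11))
    also have "\<dots> = Comp ?E (farr (ncod t) (farr (ncod s) f))
        (Comp ?E (ncmp t (fobj (ncod s) ?x)) (farr (ndom t) (ncmp s ?x)))"
      using f T(9)[of "farr (ncod s) f"] by (simp add: simps E(11))
    finally show ?case using f S(3) by (simp add: hcomp_ntrans_def comp_functor_def C)
  qed (use simps 12 st in \<open>auto simp: hcomp_ntrans_def\<close>, (use simps in \<open>auto simp: comp_functor_def\<close>))
qed

lemma hcomp_ntrans_id:
  assumes "is_functor F" "is_functor G" "fdom G = fcod F"
  shows "hcomp_ntrans (id_ntrans G) (id_ntrans F) = id_ntrans (comp_functor G F)"
proof -
  note F = is_functorD[OF assms(1)] and G = is_functorD[OF assms(2), unfolded assms(3)]
  note E = categoryD[OF G(2)]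
  show ?thesis
    using assms(3) by (auto simp: hcomp_ntrans_def id_ntrans_def comp_functor_def F G E fun_eq_iff restrict_def)
qed

lemma hcomp_ntrans_id_functor:
  assumes "is_ntrans t"
  shows "hcomp_ntrans t (id_ntrans (id_functor (fdom (ndom t)))) = t"
    "hcomp_ntrans (id_ntrans (id_functor (fcod (ndom t)))) t = t"
proof -
  note T = is_ntransD[OF assms]
  note F = is_functorD[OF T(1)] and G = is_functorD[OF T(2), unfolded T(3,4)]
  note D = categoryD[OF F(2)]
  have *: "is_ntrans (hcomp_ntrans t (id_ntrans (id_functor (fdom (ndom t)))))"
    "is_ntrans (hcomp_ntrans (id_ntrans (id_functor (fcod (ndom t)))) t)"
    using assms F by (auto intro!: is_ntrans_hcomp is_ntrans_id is_functor_id)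
  have i: "comp_functor (ndom t) (id_functor (fdom (ndom t))) = ndom t"
    "comp_functor (ncod t) (id_functor (fdom (ndom t))) = ncod t"
    "comp_functor (id_functor (fcod (ndom t))) (ndom t) = ndom t"
    "comp_functor (id_functor (fcod (ndom t))) (ncod t) = ncod t"
    using comp_functor_id[OF T(1)] comp_functor_id[OF T(2)] T(3,4) by auto
  show "hcomp_ntrans t (id_ntrans (id_functor (fdom (ndom t)))) = t"
    by (rule ntrans_eqI[OF *(1) assms]) (simp_all add: hcomp_ntrans_def id_ntrans_def i,
      simp_all add: id_functor_def F D T categoryD[OF F(1)])
  show "hcomp_ntrans (id_ntrans (id_functor (fcod (ndom t)))) t = t"
    by (rule ntrans_eqI[OF *(2) assms]) (simp_all add: hcomp_ntrans_def id_ntrans_def i,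
      simp_all add: id_functor_def F G D T)
qed

lemma hcomp_ntrans_assoc:
  assumes r: "is_ntrans r" and s: "is_ntrans s" and t: "is_ntrans t"
    and rs: "fdom (ndom s) = fcod (ndom r)" and st: "fdom (ndom t) = fcod (ndom s)"
  shows "hcomp_ntrans t (hcomp_ntrans s r) = hcomp_ntrans (hcomp_ntrans t s) r"
proof -
  note R = is_ntransD[OF r] and S = is_ntransD[OF s, unfolded rs] and T = is_ntransD[OF t, unfolded st]
  note FR = is_functorD[OF R(1)] is_functorD[OF R(2), unfolded R(3,4)]
  note FS = is_functorD[OF S(1), unfolded rs] is_functorD[OF S(2), unfolded S(3,4)]
  note FT = is_functorD[OF T(1), unfolded st] is_functorD[OF T(2), unfolded T(3,4)]
  note cats = categoryD(1-10)[OF FR(1)] categoryD(1-10)[OF FR(2)] categoryD(1-10)[OF FS(2)]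
    categoryD[OF FT(2)]
  have "comp_functor (ndom t) (comp_functor (ndom s) (ndom r)) =
      comp_functor (comp_functor (ndom t) (ndom s)) (ndom r)"
    "comp_functor (ncod t) (comp_functor (ncod s) (ncod r)) =
      comp_functor (comp_functor (ncod t) (ncod s)) (ncod r)"
    using R S T rs st by (auto intro!: comp_functor_assoc)
  then show ?thesis
    by (auto simp: hcomp_ntrans_def comp_functor_def R(1-8) S(1-8) T(1-8) FR FS FT rs st cats
        intro!: restrict_ext)
qed

lemma hcomp_vcomp_ntrans:
  assumes s: "is_ntrans s" and s': "is_ntrans s'" and t: "is_ntrans t" and t': "is_ntrans t'"
    and ss: "ndom s' = ncod s" and tt: "ndom t' = ncod t" and st: "fdom (ndom t) = fcod (ndom s)"
  shows "hcomp_ntrans (vcomp_ntrans t' t) (vcomp_ntrans s' s) =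
    vcomp_ntrans (hcomp_ntrans t' s') (hcomp_ntrans t s)"
proof -
  note S = is_ntransD[OF s] and T = is_ntransD[OF t, unfolded st]
  note S' = is_ntransD[OF s', unfolded ss S(3,4)] and T' = is_ntransD[OF t', unfolded tt T(3,4)]
  note FS = is_functorD[OF S(1)] is_functorD[OF S(2), unfolded S(3,4)]
    is_functorD[OF S'(2), unfolded S'(3,4)]
  note FT = is_functorD[OF T(1), unfolded st] is_functorD[OF T(2), unfolded T(3,4)]
    is_functorD[OF T'(2), unfolded T'(3,4)]
  let ?E = "fcod (ndom t)"
  note cats = categoryD(1-10)[OF FS(1)] categoryD(1-10)[OF FS(2)] categoryD(1-10)[OF FT(2)]
  note assoc = categoryD(11)[OF FT(2)]
  note simps = S(1-8) S'(1-8) T(1-8) T'(1-8) FS FT cats st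
  have "Comp ?E (Comp ?E (ncmp t' (fobj (ncod s') x)) (ncmp t (fobj (ncod s') x)))
      (farr (ndom t) (Comp (fcod (ndom s)) (ncmp s' x) (ncmp s x))) =
    Comp ?E (Comp ?E (ncmp t' (fobj (ncod s') x)) (farr (ncod t) (ncmp s' x)))
      (Comp ?E (ncmp t (fobj (ncod s) x)) (farr (ndom t) (ncmp s x)))" (is "?l = ?r")
    if x: "x \<in> Obj (fdom (ndom s))" for x
  proof -
    have "?l = Comp ?E (ncmp t' (fobj (ncod s') x))
      (Comp ?E (Comp ?E (ncmp t (fobj (ncod s') x)) (farr (ndom t) (ncmp s' x))) (farr (ndom t) (ncmp s x)))"
      using x by (simp add: simps assoc)
    \<comment> \<open>Naturality of \<open>t\<close> at the arrow \<open>ncmp s' x\<close> exchanges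
      the two middle factors; the rest is functoriality and associativity.\<close>
    also have "Comp ?E (ncmp t (fobj (ncod s') x)) (farr (ndom t) (ncmp s' x)) =
        Comp ?E (farr (ncod t) (ncmp s' x)) (ncmp t (fobj (ncod s) x))"
      using x T(9)[of "ncmp s' x"] by (simp add: simps)
    also have "Comp ?E (ncmp t' (fobj (ncod s') x)) (Comp ?E \<dots> (farr (ndom t) (ncmp s x))) = ?r"
      using x by (simp add: simps assoc)
    finally show ?thesis .
  qed
  then show ?thesis
    by (auto simp: hcomp_ntrans_def vcomp_ntrans_def comp_functor_def ss tt st S T FS intro!: restrict_ext)
qed

lemma two_category_Cat: "two_category Cat"
proof -
  have s: "category C" if "small_category C" for C :: "('u, 'u) cat"
    using that by (simp add: small_category_def)
  show ?thesis
    unfolding two_category_def Cat_def two_cat.simps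
  proof (intro conjI, goal_cases)
    case 1
    show ?case
      unfolding category_def cat.simps
      by (auto simp: is_functor_id s is_functor_comp comp_functor_id comp_functor_assoc)
  next
    case 2
    show ?case
      unfolding category_def cat.simps
      by (auto simp: is_ntrans_id is_ntrans_vcomp vcomp_ntrans_id vcomp_ntrans_assoc is_ntransD)
  next
    case 3
    show ?case
      unfolding category_def cat.simps
      by (auto simp: is_ntrans_id is_functor_id s is_ntrans_hcomp hcomp_ntrans_id_functor
          hcomp_ntrans_assoc is_ntransD)
  qed (auto simp: is_ntransD hcomp_ntrans_id hcomp_vcomp_ntrans)
qed

section \<open>Cylinders of small categories\<close>

text \<open>The product of \<open>C\<close> with the arrow category, moved into the universe along an injection \<open>e\<close>: the
  object $(x, a)$ is coded by \<open>e (x, a, a)\<close>, and \<open>e (f, a, b)\<close> codes the arrow given by \<open>f\<close> and the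
  unique arrow $a \to b$.\<close>

definition arrow_cylinder ::
  "('u \<times> bool \<times> bool \<Rightarrow> 'u) \<Rightarrow> ('u, 'u) cat \<Rightarrow> ('u, 'u) cat" where
  "arrow_cylinder e C =
     (let Os = {e (x, a, a) | x a. x \<in> Obj C};
          As = {e (f, a, b) | f a b. f \<in> Arr C \<and> a \<le> b};
          src = (\<lambda>z\<in>As. case inv e z of (f, a, b) \<Rightarrow> e (Dom C f, a, a));
          tgt = (\<lambda>z\<in>As. case inv e z of (f, a, b) \<Rightarrow> e (Cod C f, b, b))
      in \<lparr>Obj = Os, Arr = As, Dom = src, Cod = tgt,
          Ident = (\<lambda>z\<in>Os. case inv e z of (x, a, b) \<Rightarrow> e (Ident C x, a, a)),
          Comp = (\<lambda>w z. if w \<in> As \<and> z \<in> As \<and> src w = tgt z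
            then case inv e w of (g, b, c) \<Rightarrow> case inv e z of (f, a, b') \<Rightarrow> e (Comp C g f, a, c)
            else undefined)\<rparr>)"

text \<open>The inclusion of \<open>C\<close> at one of the two objects \<open>False\<close> and
  \<open>True\<close> of the arrow category.\<close>

definition cylinder_end ::
  "('u \<times> bool \<times> bool \<Rightarrow> 'u) \<Rightarrow> ('u, 'u) cat \<Rightarrow> bool \<Rightarrow> ('u, 'u, 'u, 'u) func" where
  "cylinder_end e C a = \<lparr>fdom = C, fcod = arrow_cylinder e C,
     fobj = (\<lambda>x\<in>Obj C. e (x, a, a)), farr = (\<lambda>f\<in>Arr C. e (f, a, a))\<rparr>"

text \<open>The universal 2-morphism \<open>\<theta>\<close>, induced by the arrow from
  \<open>False\<close> to \<open>True\<close>.\<close>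

definition cylinder_cell ::
  "('u \<times> bool \<times> bool \<Rightarrow> 'u) \<Rightarrow> ('u, 'u) cat \<Rightarrow> ('u, 'u, 'u, 'u) ntrans" where
  "cylinder_cell e C = \<lparr>ndom = cylinder_end e C False, ncod = cylinder_end e C True,
     ncmp = (\<lambda>x\<in>Obj C. e (Ident C x, False, True))\<rparr>"

text \<open>The transpose of \<open>t\<close>. An arrow \<open>f\<close> paired with the arrow from
  \<open>False\<close> to \<open>True\<close> goes to the diagonal of the naturality square of
  \<open>t\<close> at \<open>f\<close>.\<close>

definition cylinder_functor ::
  "('u \<times> bool \<times> bool \<Rightarrow> 'u) \<Rightarrow> ('u, 'u, 'u, 'u) ntrans \<Rightarrow> ('u, 'u, 'u, 'u) func" where
  "cylinder_functor e t =
     (let C = fdom (ndom t); D = fcod (ndom t) in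
       \<lparr>fdom = arrow_cylinder e C, fcod = D,
        fobj = (\<lambda>z\<in>Obj (arrow_cylinder e C). case inv e z of (x, a, b) \<Rightarrow>
          fobj (if a then ncod t else ndom t) x),
        farr = (\<lambda>z\<in>Arr (arrow_cylinder e C). case inv e z of (f, a, b) \<Rightarrow>
          if \<not> a \<and> b then Comp D (ncmp t (Cod C f)) (farr (ndom t) f)
          else farr (if a then ncod t else ndom t) f)\<rparr>)"

section \<open>The coded product as a small category\<close>

locale cylinder_code =
  fixes e :: "'u \<times> bool \<times> bool \<Rightarrow> 'u"
  assumes inj_e: "inj e"
begin

lemma e_simps [simp]: "inv e (e p) = p" "e p = e q \<longleftrightarrow> p = q"
  using inj_e by (auto simp: inj_eq)

lemma Obj_arrow_cylinder: "Obj (arrow_cylinder e C) = {e (x, a, a) | x a. x \<in> Obj C}"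
  and Arr_arrow_cylinder: "Arr (arrow_cylinder e C) = {e (f, a, b) | f a b. f \<in> Arr C \<and> a \<le> b}"
  by (simp_all add: arrow_cylinder_def Let_def)

lemma in_arrow_cylinder [simp]:
  "e (x, a, b) \<in> Obj (arrow_cylinder e C) \<longleftrightarrow> x \<in> Obj C \<and> a = b"
  "e (x, a, b) \<in> Arr (arrow_cylinder e C) \<longleftrightarrow> x \<in> Arr C \<and> a \<le> b"
  by (auto simp: Obj_arrow_cylinder Arr_arrow_cylinder)

lemma arrow_cylinder_simps [simp]:
  "\<lbrakk>f \<in> Arr C; a \<le> b\<rbrakk> \<Longrightarrow> Dom (arrow_cylinder e C) (e (f, a, b)) = e (Dom C f, a, a)"
  "\<lbrakk>f \<in> Arr C; a \<le> b\<rbrakk> \<Longrightarrow> Cod (arrow_cylinder e C) (e (f, a, b)) = e (Cod C f, b, b)"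
  "x \<in> Obj C \<Longrightarrow> Ident (arrow_cylinder e C) (e (x, a, a)) = e (Ident C x, a, a)"
  "\<lbrakk>f \<in> Arr C; g \<in> Arr C; Dom C g = Cod C f; a \<le> b; b \<le> c\<rbrakk> \<Longrightarrow>
    Comp (arrow_cylinder e C) (e (g, b, c)) (e (f, a, b)) = e (Comp C g f, a, c)"
  by (auto simp: arrow_cylinder_def Let_def)

lemma Arr_arrow_cylinderE:
  assumes "z \<in> Arr (arrow_cylinder e C)"
  obtains f a b where "z = e (f, a, b)" "f \<in> Arr C" "a \<le> b"
  using assms unfolding Arr_arrow_cylinder by blast

text \<open>The order on \<open>bool\<close> is implication, so the arrow category has just its two
  identities and one arrow from \<open>False\<close> to \<open>True\<close>.\<close>

lemma Arr_arrow_cylinder_cases: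
  assumes "z \<in> Arr (arrow_cylinder e C)"
  obtains (over_end) f a where "z = e (f, a, a)" "f \<in> Arr C"
  | (middle) f where "z = e (f, False, True)" "f \<in> Arr C"
  using assms by (rule Arr_arrow_cylinderE) (metis (full_types) le_boolE)

lemma category_arrow_cylinder:
  assumes "category C"
  shows "category (arrow_cylinder e C)"
proof -
  note C = categoryD[OF assms]
  let ?T = "arrow_cylinder e C"
  show ?thesis
    unfolding category_def
  proof (intro conjI ballI impI; (elim conjE)?)
    fix p assume "p \<in> Arr ?T"
    then obtain f a b where p: "p = e (f, a, b)" "f \<in> Arr C" "a \<le> b" by (rule Arr_arrow_cylinderE)
    then show "Dom ?T p \<in> Obj ?T" "Cod ?T p \<in> Obj ?T"
      "Comp ?T p (Ident ?T (Dom ?T p)) = p" "Comp ?T (Ident ?T (Cod ?T p)) p = p"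
      by (simp_all add: C)
    fix q assume "q \<in> Arr ?T" and pq: "Dom ?T q = Cod ?T p"
    then obtain g b' c where q: "q = e (g, b', c)" "g \<in> Arr C" "b' \<le> c"
      by (blast elim: Arr_arrow_cylinderE)
    from pq p q have [simp]: "Dom C g = Cod C f" "b' = b" by simp_all
    have ac: "a \<le> c" using p(3) q(3) by simp
    show "Comp ?T q p \<in> Arr ?T" "Dom ?T (Comp ?T q p) = Dom ?T p" "Cod ?T (Comp ?T q p) = Cod ?T q"
      using p q ac by (simp_all add: C)
    fix r assume "r \<in> Arr ?T" and qr: "Dom ?T r = Cod ?T q"
    then obtain h c' d where r: "r = e (h, c', d)" "h \<in> Arr C" "c' \<le> d"
      by (blast elim: Arr_arrow_cylinderE)
    from qr q r have [simp]: "Dom C h = Cod C g" "c' = c" by simp_all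
    have bd: "b \<le> d" using q(3) r(3) by simp
    show "Comp ?T r (Comp ?T q p) = Comp ?T (Comp ?T r q) p"
      using p q r ac bd by (simp add: C)
  next
    fix z assume "z \<in> Obj ?T"
    then obtain x a where "z = e (x, a, a)" "x \<in> Obj C" unfolding Obj_arrow_cylinder by blast
    then show "Ident ?T z \<in> Arr ?T" "Dom ?T (Ident ?T z) = z" "Cod ?T (Ident ?T z) = z"
      by (simp_all add: C)
  qed
qed

text \<open>Four copies of a finite set are finite, and four copies of an infinite set are
  equinumerous with it; either way the cardinality stays below that of \<open>'u\<close>.\<close>

lemma small_set_image:
  includes cardinal_syntax
  assumes "infinite (UNIV :: 'u set)" "small_set S" "T \<subseteq> e ` (S \<times> UNIV)"
  shows "small_set T"
proof -
  have fin: "finite (UNIV :: (bool \<times> bool) set)" by simp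
  have "|T| \<le>o |e ` (S \<times> (UNIV :: (bool \<times> bool) set))|"
    using assms(3) by (rule card_of_mono1)
  also have "|e ` (S \<times> (UNIV :: (bool \<times> bool) set))| \<le>o |S \<times> (UNIV :: (bool \<times> bool) set)|"
    by (rule card_of_image)
  finally have le: "|T| \<le>o |S \<times> (UNIV :: (bool \<times> bool) set)|" .
  have "|S \<times> (UNIV :: (bool \<times> bool) set)| <o |UNIV :: 'u set|"
  proof (cases "finite S")
    case True
    then have "finite (S \<times> (UNIV :: (bool \<times> bool) set))" by simp
    then show ?thesis
      using assms(1) by (intro finite_ordLess_infinite card_of_Well_order) (simp_all add: Field_card_of)
  next
    case False
    with fin have "|UNIV :: (bool \<times> bool) set| <o |S|"
      by (intro finite_ordLess_infinite card_of_Well_order) (simp_all add: Field_card_of)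
    then have "|UNIV :: (bool \<times> bool) set| \<le>o |S|" by (rule ordLess_imp_ordLeq)
    with False have "|S \<times> (UNIV :: (bool \<times> bool) set)| =o |S|"
      by (intro card_of_Times_infinite_simps) auto
    then show ?thesis
      using assms(2) unfolding small_set_def by (rule ordIso_ordLess_trans)
  qed
  with le show ?thesis
    unfolding small_set_def by (rule ordLeq_ordLess_trans)
qed

text \<open>The restricted operations and the \<open>undefined\<close> branch of
  \<open>arrow_cylinder\<close> provide the extensionality that \<open>small_category\<close>
  demands.\<close>

lemma small_category_arrow_cylinder:
  assumes "infinite (UNIV :: 'u set)" "small_category C"
  shows "small_category (arrow_cylinder e C)"
proof -
  have "Obj (arrow_cylinder e C) \<subseteq> e ` (Obj C \<times> UNIV)" "Arr (arrow_cylinder e C) \<subseteq> e ` (Arr C \<times> UNIV)"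
    unfolding Obj_arrow_cylinder Arr_arrow_cylinder by blast+
  then have "small_set (Obj (arrow_cylinder e C))" "small_set (Arr (arrow_cylinder e C))"
    using assms by (auto intro: small_set_image simp: small_category_def)
  then show ?thesis
    using assms category_arrow_cylinder[of C] unfolding small_category_def
    by (auto simp: arrow_cylinder_def Let_def)
qed

lemma is_functor_cylinder_end:
  assumes "category C"
  shows "is_functor (cylinder_end e C a)"
  by (rule is_functorI)
    (auto simp: cylinder_end_def assms category_arrow_cylinder categoryD[OF assms])

lemma is_ntrans_cylinder_cell:
  assumes "category C"
  shows "is_ntrans (cylinder_cell e C)"
proof (rule is_ntransI, goal_cases)
  case 1
  show ?case using is_functor_cylinder_end[OF assms] by (simp add: cylinder_cell_def)
next
  case 2
  show ?case using is_functor_cylinder_end[OF assms] by (simp add: cylinder_cell_def)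
qed (auto simp: cylinder_cell_def cylinder_end_def categoryD[OF assms])

section \<open>The universal property of the coded product\<close>

lemma is_functor_cylinder_functor:
  assumes "is_ntrans t"
  shows "is_functor (cylinder_functor e t)"
proof -
  note T = is_ntransD[OF assms]
  note F = is_functorD[OF T(1)] and G = is_functorD[OF T(2), unfolded T(3,4)]
  note C = categoryD[OF F(1)] and D = categoryD(1-10)[OF F(2)]
  note assoc = categoryD(11)[OF F(2)]
  let ?C = "fdom (ndom t)" and ?D = "fcod (ndom t)"
  note simps = T(1-8) F G C D
  define P where "P = cylinder_functor e t"
  have dom: "fdom P = arrow_cylinder e ?C" "fcod P = ?D"
    by (simp_all add: P_def cylinder_functor_def Let_def)
  have ob: "fobj P (e (x, a, a)) = fobj (if a then ncod t else ndom t) x" if "x \<in> Obj ?C" for x a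
    using that by (simp add: P_def cylinder_functor_def Let_def)
  have ar: "farr P (e (f, a, a)) = farr (if a then ncod t else ndom t) f"
    "farr P (e (f, False, True)) = Comp ?D (ncmp t (Cod ?C f)) (farr (ndom t) f)" if "f \<in> Arr ?C" for f a
    using that by (simp_all add: P_def cylinder_functor_def Let_def)
  have "is_functor P"
  proof (rule is_functorI, unfold dom, goal_cases)
    case 1
    then show ?case by (simp add: category_arrow_cylinder F)
  next
    case 2
    then show ?case by (simp add: F)
  next
    case (3 x)
    then show ?case by (auto simp: Obj_arrow_cylinder ob simps)
  next
    case (4 f)
    then show ?case by (cases rule: Arr_arrow_cylinder_cases) (auto simp: ob ar simps)
  next
    case 5
    then show ?case by (simp add: P_def cylinder_functor_def Let_def)
  next
    case 6
    then show ?case by (simp add: P_def cylinder_functor_def Let_def)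
  next
    case (7 f)
    then show ?case by (cases rule: Arr_arrow_cylinder_cases) (auto simp: ob ar simps)
  next
    case (8 f)
    then show ?case by (cases rule: Arr_arrow_cylinder_cases) (auto simp: ob ar simps)
  next
    case (9 x)
    then show ?case by (auto simp: Obj_arrow_cylinder ob ar simps)
  next
    case (10 p q)
    then obtain f a b g b' c where p: "p = e (f, a, b)" "f \<in> Arr ?C" "a \<le> b"
      and q: "q = e (g, b', c)" "g \<in> Arr ?C" "b' \<le> c"
      unfolding Arr_arrow_cylinder by blast
    with 10(3) have gf: "Dom ?C g = Cod ?C f" and b': "b' = b" by auto
    have pq: "Comp (arrow_cylinder e ?C) q p = e (Comp ?C g f, a, c)"
      using p q gf b' by simp
    have nat: "Comp ?D (ncmp t (Cod ?C g)) (farr (ndom t) g) = Comp ?D (farr (ncod t) g) (ncmp t (Cod ?C f))"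
      using T(9)[OF q(2)] gf by simp
    \<comment> \<open>The composite stays over one end, crosses over in \<open>q\<close>, or crosses
      over in \<open>p\<close>. The last case calls for naturality of \<open>t\<close>, to move
      \<open>g\<close> past the component.\<close>
    consider "a = b" "b = c" | "\<not> a" "\<not> b" "c" | "\<not> a" "b" "c" using p q b' by auto
    then show ?case
    proof cases
      case 1
      then show ?thesis unfolding pq using p q gf b' by (simp add: ar simps)
    next
      case 2
      then show ?thesis unfolding pq using p q gf b' by (simp add: ar simps assoc)
    next
      case 3
      have "Comp ?D (ncmp t (Cod ?C g)) (Comp ?D (farr (ndom t) g) (farr (ndom t) f)) =
        Comp ?D (Comp ?D (ncmp t (Cod ?C g)) (farr (ndom t) g)) (farr (ndom t) f)"
        using p q gf by (simp add: simps assoc)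
      also have "\<dots> = Comp ?D (farr (ncod t) g) (Comp ?D (ncmp t (Cod ?C f)) (farr (ndom t) f))"
        unfolding nat using p q gf by (simp add: simps assoc)
      finally show ?thesis unfolding pq using 3 p q gf b' by (simp add: ar simps)
    qed
  qed
  then show ?thesis by (simp add: P_def)
qed

lemma whisker_cylinder_cell:
  assumes h: "is_functor h" and "fdom h = arrow_cylinder e C" and C: "category C"
  shows "is_ntrans (hcomp_ntrans (id_ntrans h) (cylinder_cell e C))"
    and "x \<in> Obj C \<Longrightarrow>
      ncmp (hcomp_ntrans (id_ntrans h) (cylinder_cell e C)) x = farr h (e (Ident C x, False, True))"
    and "ndom (hcomp_ntrans (id_ntrans h) (cylinder_cell e C)) = comp_functor h (cylinder_end e C False)"
    and "ncod (hcomp_ntrans (id_ntrans h) (cylinder_cell e C)) = comp_functor h (cylinder_end e C True)"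
proof -
  note H = is_functorD[OF h, unfolded assms(2)]
  show "is_ntrans (hcomp_ntrans (id_ntrans h) (cylinder_cell e C))"
    using assms by (intro is_ntrans_hcomp is_ntrans_id is_ntrans_cylinder_cell)
      (simp_all add: cylinder_cell_def cylinder_end_def)
  show "ncmp (hcomp_ntrans (id_ntrans h) (cylinder_cell e C)) x = farr h (e (Ident C x, False, True))"
    if "x \<in> Obj C"
    using that assms(2) by (simp add: hcomp_ntrans_def id_ntrans_def cylinder_cell_def cylinder_end_def
        H categoryD[OF C] categoryD[OF H(2)])
qed (simp_all add: cylinder_cell_def)

text \<open>The ends and the cell generate the cylinder. The boundaries of the whiskered cell
  determine a functor on the two ends, its components determine it on the arrows
  \<open>e (Ident C x, False, True)\<close>, and any other crossing arrow is such an arrow after one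
  over the end \<open>False\<close>.\<close>

lemma cylinder_functor_eqI:
  assumes h: "is_functor h" and k: "is_functor k" and C: "category C"
    and dom: "fdom h = arrow_cylinder e C" "fdom k = arrow_cylinder e C" and cod: "fcod h = fcod k"
    and eq: "hcomp_ntrans (id_ntrans h) (cylinder_cell e C) = hcomp_ntrans (id_ntrans k) (cylinder_cell e C)"
  shows "h = k"
proof -
  note H = is_functorD[OF h, unfolded dom] and K = is_functorD[OF k, unfolded dom]
  note wh = whisker_cylinder_cell[OF h dom(1) C] and wk = whisker_cylinder_cell[OF k dom(2) C]
  have *: "comp_functor h (cylinder_end e C a) = comp_functor k (cylinder_end e C a)" for a
    by (cases a) (use eq wh(3,4) wk(3,4) in metis)+
  have ends: "fobj h (e (x, a, a)) = fobj k (e (x, a, a))" if "x \<in> Obj C" for x a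
    using arg_cong[OF *, of "\<lambda>F. fobj F x" a] that by (simp add: comp_functor_def cylinder_end_def)
  have arr_ends: "farr h (e (f, a, a)) = farr k (e (f, a, a))" if "f \<in> Arr C" for f a
    using arg_cong[OF *, of "\<lambda>F. farr F f" a] that by (simp add: comp_functor_def cylinder_end_def)
  have mid: "farr h (e (Ident C x, False, True)) = farr k (e (Ident C x, False, True))" if "x \<in> Obj C" for x
    using eq wh(2)[OF that] wk(2)[OF that] by simp
  have arr_middle: "farr h (e (f, False, True)) = farr k (e (f, False, True))" if f: "f \<in> Arr C" for f
  proof -
    let ?p = "e (Ident C (Cod C f), False, True)" and ?q = "e (f, False, False)"
    have *: "e (f, False, True) = Comp (arrow_cylinder e C) ?p ?q"
      using f by (simp add: categoryD[OF C])
    show ?thesis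
      unfolding * using f arr_ends[OF f] mid[of "Cod C f"] H(10)[of ?q ?p] K(10)[of ?q ?p] cod
      by (simp add: categoryD[OF C])
  qed
  have "farr h z = farr k z" if "z \<in> Arr (arrow_cylinder e C)" for z
    using that by (cases rule: Arr_arrow_cylinder_cases) (simp_all add: arr_ends arr_middle)
  moreover have "fobj h z = fobj k z" if "z \<in> Obj (arrow_cylinder e C)" for z
    using that ends by (auto simp: Obj_arrow_cylinder)
  ultimately show ?thesis
    using h k dom cod by (intro func_eqI) auto
qed

text \<open>The diagonal of a naturality square at an identity is the component itself.\<close>

lemma whisker_cylinder_functor:
  assumes t: "is_ntrans t"
  shows "hcomp_ntrans (id_ntrans (cylinder_functor e t)) (cylinder_cell e (fdom (ndom t))) = t"
proof -
  let ?C = "fdom (ndom t)" and ?P = "cylinder_functor e t"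
  note T = is_ntransD[OF t]
  note F = is_functorD[OF T(1)] and G = is_functorD[OF T(2), unfolded T(3,4)]
  have "fdom ?P = arrow_cylinder e ?C" "fcod ?P = fcod (ndom t)"
    by (simp_all add: cylinder_functor_def Let_def)
  note W = whisker_cylinder_cell[OF is_functor_cylinder_functor[OF t] this(1) F(1)] and P = this
  have end_f: "is_functor (comp_functor ?P (cylinder_end e ?C a))" for a
    using is_functor_cylinder_functor[OF t] is_functor_cylinder_end[OF F(1)] P
    by (intro is_functor_comp) (simp_all add: cylinder_end_def)
  have ends: "comp_functor ?P (cylinder_end e ?C a) = (if a then ncod t else ndom t)" for a
  proof (rule func_eqI[OF end_f])
    show "is_functor (if a then ncod t else ndom t)" using T by simp
  qed (auto simp: T(3,4) P cylinder_end_def comp_functor_def cylinder_functor_def Let_def)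
  show ?thesis
  proof (rule ntrans_eqI[OF W(1) t])
    fix x assume x: "x \<in> Obj ?C"
    then have "farr ?P (e (Ident ?C x, False, True)) =
      Comp (fcod (ndom t)) (ncmp t x) (farr (ndom t) (Ident ?C x))"
      by (simp add: cylinder_functor_def Let_def categoryD[OF F(1)])
    also have "\<dots> = ncmp t x"
      using x by (simp add: F T categoryD[OF F(2)])
    finally show "ncmp (hcomp_ntrans (id_ntrans ?P) (cylinder_cell e ?C)) x = ncmp t x"
      using x by (simp add: W(2))
  qed (simp_all only: W(3,4) ends if_True if_False)
qed

text \<open>The ends are jointly faithful because every object of the cylinder lies on one of them
  and a natural transformation is determined by its components at objects.\<close>

lemma is_cylinder_arrow_cylinder:
  assumes inf: "infinite (UNIV :: 'u set)" and C: "small_category C"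
  shows "is_cylinder Cat C (arrow_cylinder e C) (cylinder_cell e C)"
proof -
  note T = small_category_arrow_cylinder[OF inf C]
  have cat: "category C" using C by (simp add: small_category_def)
  have cell: "is_ntrans (cylinder_cell e C)" "fdom (ndom (cylinder_cell e C)) = C"
    "fcod (ndom (cylinder_cell e C)) = arrow_cylinder e C"
    using is_ntrans_cylinder_cell[OF cat] by (simp_all add: cylinder_cell_def cylinder_end_def)
  show ?thesis
    unfolding is_cylinder_def
  proof (intro conjI ballI impI)
    show "arrow_cylinder e C \<in> Obj0 Cat" using T by (simp add: Cat_def)
    show "cylinder_cell e C \<in> Arr (hom_cat Cat C (arrow_cylinder e C))"
      using T C cell by (simp add: Cat_def)
  next
    fix Y :: "('u, 'u) cat"
    assume Y: "Y \<in> Obj0 Cat"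
    show "bij_betw (\<lambda>f. hcomp Cat (id2 Cat f) (cylinder_cell e C))
      (Obj (hom_cat Cat (arrow_cylinder e C) Y)) (Arr (hom_cat Cat C Y))"
    proof (rule bij_betwI', goal_cases)
      case (1 h k)
      then show ?case
        using cylinder_functor_eqI[OF _ _ cat, of h k] by (auto simp: Cat_def)
    next
      case (2 h)
      then show ?case
        using whisker_cylinder_cell(1,3)[of h C] cat C by (auto simp: Cat_def cylinder_end_def)
    next
      case (3 t)
      then have t: "is_ntrans t" "fdom (ndom t) = C" "fcod (ndom t) = Y" by (simp_all add: Cat_def)
      have "cylinder_functor e t \<in> Obj (hom_cat Cat (arrow_cylinder e C) Y)"
        using is_functor_cylinder_functor[OF t(1)] t(2,3) T Y
        by (simp add: Cat_def) (simp add: cylinder_functor_def Let_def)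
      moreover have "t = hcomp Cat (id2 Cat (cylinder_functor e t)) (cylinder_cell e C)"
        using whisker_cylinder_functor[OF t(1)] t(2) by (simp add: Cat_def)
      ultimately show ?case by blast
    qed
  next
    fix Y :: "('u, 'u) cat" and b c
    assume b: "b \<in> Arr (hom_cat Cat (arrow_cylinder e C) Y)"
      and c: "c \<in> Arr (hom_cat Cat (arrow_cylinder e C) Y)"
      and bc: "dom2 Cat b = dom2 Cat c" "cod2 Cat b = cod2 Cat c"
      and e0: "hcomp Cat b (id2 Cat (dom2 Cat (cylinder_cell e C))) =
        hcomp Cat c (id2 Cat (dom2 Cat (cylinder_cell e C)))"
      and e1: "hcomp Cat b (id2 Cat (cod2 Cat (cylinder_cell e C))) =
        hcomp Cat c (id2 Cat (cod2 Cat (cylinder_cell e C)))"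
    \<comment> \<open>Whiskering with an end evaluates \<open>t\<close> on that end: the extra
      factor in \<open>hcomp_ntrans\<close> is the image of an identity.\<close>
    have whisker_end: "ncmp (hcomp_ntrans t (id_ntrans (cylinder_end e C a))) x = ncmp t (e (x, a, a))"
      if t: "t \<in> Arr (hom_cat Cat (arrow_cylinder e C) Y)" and x: "x \<in> Obj C" for t a x
    proof -
      have n: "is_ntrans t" and d: "fdom (ndom t) = arrow_cylinder e C"
        using t by (simp_all add: Cat_def)
      note N = is_ntransD[OF n, unfolded d]
      note F = is_functorD[OF N(1), unfolded d]
      have "farr (ndom t) (e (Ident C x, a, a)) = Ident (fcod (ndom t)) (fobj (ndom t) (e (x, a, a)))"
        using F(9)[of "e (x, a, a)"] x by simp
      then show ?thesis
        using x by (simp add: hcomp_ntrans_def id_ntrans_def)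
          (simp add: cylinder_end_def N categoryD[OF F(2)])
    qed
    have "ncmp b (e (x, a, a)) = ncmp c (e (x, a, a))" if "x \<in> Obj C" for x a
      using e0 e1 whisker_end[OF b that, of a] whisker_end[OF c that, of a]
      by (cases a) (simp_all add: Cat_def cylinder_cell_def)
    then show "b = c"
      using b c bc by (intro ntrans_eqI) (auto simp: Cat_def Obj_arrow_cylinder)
  qed
qed

end

text \<open>Multiplying an infinite cardinality by a finite nonzero one does not increase it, which
  yields the injection \<open>e\<close>.\<close>

lemma ex_cylinder_Cat:
  includes cardinal_syntax
  assumes inf: "infinite (UNIV :: 'u set)" and "C \<in> Obj0 (Cat :: (('u, 'u) cat, _, _) two_cat)"
  shows "\<exists>T \<theta>. is_cylinder Cat C T \<theta>"
proof -
  have "|UNIV :: (bool \<times> bool) set| <o |UNIV :: 'u set|"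
    using inf by (intro finite_ordLess_infinite card_of_Well_order) (simp_all add: Field_card_of)
  then have "|(UNIV :: 'u set) \<times> (UNIV :: (bool \<times> bool) set)| \<le>o |UNIV :: 'u set|"
    using card_of_Times_infinite_simps(1)[OF inf, of "UNIV :: (bool \<times> bool) set"]
    by (auto intro: ordIso_imp_ordLeq ordLess_imp_ordLeq)
  then obtain e :: "'u \<times> bool \<times> bool \<Rightarrow> 'u" where "inj e"
    by (auto simp flip: card_of_ordLeq)
  then interpret cylinder_code e by unfold_locales
  show ?thesis
    using is_cylinder_arrow_cylinder[OF inf] assms(2) by (auto simp: Cat_def)
qed

theorem corollary2p14:
  fixes I :: "('i, 'j, 'k) two_cat"
    and F :: "('i, 'j, 'k, ('u, 'u) cat, ('u, 'u, 'u, 'u) func, ('u, 'u, 'u, 'u) ntrans) two_func"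
    and L :: "('u, 'u) cat"
    and l :: "('i, 'j, 'k, ('u, 'u) cat, ('u, 'u, 'u, 'u) func, ('u, 'u, 'u, 'u) ntrans) two_nat"
  assumes "infinite (UNIV :: 'u set)"
    and "two_category I"
    and "is_two_functor I Cat F"
  shows "two_terminal (strict_slice I Cat F) (L, l) \<longleftrightarrow> two_limit I Cat F (L, l)"
proof -
  interpret two_category_pair I Cat
    using assms(2) two_category_Cat by unfold_locales
  show ?thesis
    using two_limit_if_two_terminal two_terminal_if_two_limit ex_cylinder_Cat[OF assms(1)] by blast
qed

end
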